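(* Let $(x,\rho)$ and $(\tilde x,\tilde\rho)$ be a B\"acklund pair of pre-hyperbolic nets on $\mathbb{Z}^2$. If for one pair $Q,\tilde Q$ of corresponding elementary quadrilaterals of $x$ and $\tilde x$ the cube with opposite faces $Q,\tilde Q$ (equipped with their crosses) is a Weingarten cube, then $(x,\rho)$ and $(\tilde x,\tilde\rho)$ form a Weingarten pair. Conversely, if $(x,\rho)$ and $(\tilde x,\tilde\rho)$ form a Weingarten pair of pre-hyperbolic nets, then $(x,\rho)$ and $(\tilde x,\tilde\rho)$ are B\"acklund-related.
   Context: $\operatorname{inc}[\cdot]$ denotes the subspace spanned by the given points; $\mathbb{R}^3$ is regarded as the affine part of $\mathbb{R}\mathrm{P}^3$. A-net: a map $x$ from $\mathbb{Z}^2$ (A-surface) or $\mathbb{Z}^2\times\{0,1\}$ to $\mathbb{R}^3$ such that every point is coplanar with all its lattice neighbours. Standing genericity assumption: elementary quadrilaterals are skew and every vertex star spans a unique plane (the vertex plane). Two A-surfaces $x,\tilde x$ form a discrete Weingarten pair if for all $z$ the line $\operatorname{inc}[x(z),\tilde x(z)]$ is the intersection of the vertex planes at $x(z)$ and $\tilde x(z)$; equivalently $X(\cdot,0)=x$, $X(\cdot,1)=\tilde x$ defines an A-net on $\mathbb{Z}^2\times\{0,1\}$. Cross: a cross adapted to a skew quadrilateral $(x_1,x_2,x_3,x_4)$ is a quadruple of coplanar points $p_{12},p_{23},p_{34},p_{41}$ with $p_{ij}$ on the line $\operatorname{inc}[x_i,x_j]$, different from $x_i,x_j$. It determines the unique doubly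 ruled quadric (hyperboloid) containing the four extended edges and the lines $\operatorname{inc}[p_{12},p_{34}]$, $\operatorname{inc}[p_{23},p_{41}]$. Crisscrossed A-net $(x,\rho)$: an A-net $x$ with a nowhere vanishing real function $\rho$ on vertices, which defines on each extended edge with endpoints $x(z),x(z')$ the cross vertex $\frac{\rho(z)x(z)+\rho(z')x(z')}{\rho(z)+\rho(z')}$ (at infinity if the denominator vanishes); the four cross vertices on each elementary quadrilateral form a cross. $C^1$-condition for edge-adjacent quadrilaterals with crosses: the corresponding hyperboloids have the same tangent planes along the common edge line (equivalently, the endpoints of the common edge and the two cross vertices on the edges opposite to it are coplanar). A pre-hyperbolic net is a crisscrossed A-surface satisfying the $C^1$-condition for any two edge-adjacent quadrilaterals. B\"acklund pair: pre-hyperbolic nets $(x,\rho)$, $(\tilde x,\tilde\rho)$ such that $x,\tilde x$ form a discrete Weingarten pair and the crisscrossed 2-layer A-net on $\mathbb{Z}^2\times\{0,1\}$ composed of $(x,\rho)$ and $(\tilde x,\tilde\rho)$ satisfies the $C^1$-condition in every 2-dimensional coordinate layer, i.e. also for any two adjacent quadrilaterals within each of the vertical layers (the strips of the $(1,3)$- and $(2,3)$-coordinate planes). Weingarten cube: a combinatorial cube with faces $(x_1,\dots,x_4)$, $(\tilde x_1,\dots,\tilde x_4)$, $(x_i,x_{i+1},\tilde x_{i+1},\tilde x_i)$, all skew, with planar vertex stars, and with crosses $(p_{ij})$, $(\tilde p_{ij})$ adapted to $(x_1,\dots,x_4)$ and $(\tilde x_1,\dots,\tilde x_4)$ such that for all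 $i$ and $(j,k,l)=(i+1,i+2,i+3)$ modulo 4, $\operatorname{inc}[p_{ij},\tilde p_{ij}]=\operatorname{inc}[x_i,x_j,p_{kl}]\cap\operatorname{inc}[\tilde x_i,\tilde x_j,\tilde p_{kl}]$. Weingarten pair of pre-hyperbolic nets: $x,\tilde x$ form a discrete Weingarten pair and any two corresponding elementary quadrilaterals with their crosses are opposite faces of a Weingarten cube. *)

theory Defs
  imports "HOL-Analysis.Analysis"
begin

text \<open>
  Points of the real projective space are given by nonzero homogeneous coordinate vectors, the
  affine part being the image of \<^term>\<open>\<lambda>a::real^3. (a, 1::real)\<close>. The projective subspace
  inc[...] spanned by points is the linear span of their representatives: lines are
  2-dimensional and planes are 3-dimensional linear subspaces.
\<close>

type_synonym hpoint = "(real^3) \<times> real"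

definition hom :: "real^3 \<Rightarrow> hpoint" where
  "hom a = (a, 1)"

abbreviation inc :: "hpoint set \<Rightarrow> hpoint set" where
  "inc S \<equiv> span S"

definition hcoplanar :: "hpoint set \<Rightarrow> bool" where
  "hcoplanar S \<longleftrightarrow> dim S \<le> 3"

text \<open>
  Quadrilaterals are indexed cyclically by the type \<^typ>\<open>4\<close> of integers modulo 4 (so the index
  of the last vertex is \<^term>\<open>4::4\<close>, equal to 0). A quadruple \<open>p\<close> of points on the edge
  lines has \<open>p i\<close> on the line through the vertices \<open>i\<close> and \<open>i + 1\<close>.
\<close>

definition quadruple :: "'a \<Rightarrow> 'a \<Rightarrow> 'a \<Rightarrow> 'a \<Rightarrow> 4 \<Rightarrow> 'a" where
  "quadruple a b c d = (\<lambda>i. if i = 1 then a else if i = 2 then b else if i = 3 then c else d)"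

definition skew_quad :: "(4 \<Rightarrow> hpoint) \<Rightarrow> bool" where
  "skew_quad y \<longleftrightarrow> \<not> hcoplanar (range y)"

definition adapted_cross :: "(4 \<Rightarrow> hpoint) \<Rightarrow> (4 \<Rightarrow> hpoint) \<Rightarrow> bool" where
  "adapted_cross y p \<longleftrightarrow>
     (\<forall>i. p i \<in> inc {y i, y (i + 1)} \<and> p i \<notin> inc {y i} \<and> p i \<notin> inc {y (i + 1)}) \<and>
     hcoplanar (range p)"

text \<open>
  The hyperboloid determined by a cross, given by a symmetric bilinear form \<open>B\<close> (unique up to a
  nonzero factor). A nondegenerate real quadric in projective 3-space that contains a line is
  doubly ruled. The tangent plane at a point \<open>v\<close> of the quadric is the polar plane of \<open>v\<close>.
\<close>

definition hyperboloid ::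
    "(4 \<Rightarrow> hpoint) \<Rightarrow> (4 \<Rightarrow> hpoint) \<Rightarrow> (hpoint \<Rightarrow> hpoint \<Rightarrow> real) \<Rightarrow> bool" where
  "hyperboloid y p B \<longleftrightarrow>
     bilinear B \<and> (\<forall>u v. B u v = B v u) \<and> (\<forall>u. (\<forall>v. B u v = 0) \<longrightarrow> u = 0) \<and>
     (\<forall>i. inc {y i, y (i + 1)} \<subseteq> {v. B v v = 0}) \<and>
     (\<forall>i. inc {p i, p (i + 2)} \<subseteq> {v. B v v = 0})"

definition tangent_plane :: "(hpoint \<Rightarrow> hpoint \<Rightarrow> real) \<Rightarrow> hpoint \<Rightarrow> hpoint set" where
  "tangent_plane B v = {w. B v w = 0}"

definition C1_along ::
    "hpoint set \<Rightarrow> (4 \<Rightarrow> hpoint) \<Rightarrow> (4 \<Rightarrow> hpoint) \<Rightarrow> (4 \<Rightarrow> hpoint) \<Rightarrow> (4 \<Rightarrow> hpoint) \<Rightarrow> bool" where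
  "C1_along l y p y' p' \<longleftrightarrow>
     (\<exists>B B'. hyperboloid y p B \<and> hyperboloid y' p' B' \<and>
        (\<forall>v\<in>l - {0}. tangent_plane B v = tangent_plane B' v))"

text \<open>
  Nets are defined on a part \<open>D\<close> of a lattice with set of unit vectors \<open>E\<close>; this covers both
  the square lattice and its two-layer version. Values of a net outside of \<open>D\<close> are irrelevant.
\<close>

definition star :: "'v::ab_group_add set \<Rightarrow> 'v set \<Rightarrow> 'v \<Rightarrow> 'v set" where
  "star E D z = insert z {w \<in> D. \<exists>e\<in>E. w = z + e \<or> w = z - e}"

definition vertex_plane ::
    "'v::ab_group_add set \<Rightarrow> 'v set \<Rightarrow> ('v \<Rightarrow> real^3) \<Rightarrow> 'v \<Rightarrow> hpoint set" where
  "vertex_plane E D X z = inc ((\<lambda>w. hom (X w)) ` star E D z)"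

definition elementary_quad :: "'v::ab_group_add set \<Rightarrow> 'v set \<Rightarrow> 'v \<Rightarrow> 'v \<Rightarrow> 'v \<Rightarrow> bool" where
  "elementary_quad E D z e f \<longleftrightarrow>
     e \<in> E \<and> f \<in> E \<and> e \<noteq> f \<and> {z, z + e, z + e + f, z + f} \<subseteq> D"

definition quad_values :: "('v::ab_group_add \<Rightarrow> 'a) \<Rightarrow> 'v \<Rightarrow> 'v \<Rightarrow> 'v \<Rightarrow> 4 \<Rightarrow> 'a" where
  "quad_values F z e f = quadruple (F z) (F (z + e)) (F (z + e + f)) (F (z + f))"

definition net_quad ::
    "('v::ab_group_add \<Rightarrow> real^3) \<Rightarrow> 'v \<Rightarrow> 'v \<Rightarrow> 'v \<Rightarrow> 4 \<Rightarrow> hpoint" where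
  "net_quad X = quad_values (\<lambda>w. hom (X w))"

definition all_quads_skew :: "'v::ab_group_add set \<Rightarrow> 'v set \<Rightarrow> ('v \<Rightarrow> real^3) \<Rightarrow> bool" where
  "all_quads_skew E D X \<longleftrightarrow>
     (\<forall>z e f. elementary_quad E D z e f \<longrightarrow> skew_quad (net_quad X z e f))"

text \<open>
  The standing genericity assumptions are part of the definition: \<open>dim = 3\<close> says both that
  the vertex star is planar and that it spans a unique plane.
\<close>

definition A_net :: "'v::ab_group_add set \<Rightarrow> 'v set \<Rightarrow> ('v \<Rightarrow> real^3) \<Rightarrow> bool" where
  "A_net E D X \<longleftrightarrow>
     (\<forall>z\<in>D. dim (vertex_plane E D X z) = 3) \<and> all_quads_skew E D X"

text \<open>
  \<open>\<rho> a + \<rho>' a'\<close>, in homogeneous coordinates, represents the point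
  \<open>(\<rho> a + \<rho>' a') / (\<rho> + \<rho>')\<close>, which is at infinity if the denominator vanishes.
\<close>

definition cross_vertex :: "real \<Rightarrow> hpoint \<Rightarrow> real \<Rightarrow> hpoint \<Rightarrow> hpoint" where
  "cross_vertex r y r' y' = r *\<^sub>R y + r' *\<^sub>R y'"

definition net_cross ::
    "('v::ab_group_add \<Rightarrow> real^3) \<Rightarrow> ('v \<Rightarrow> real) \<Rightarrow> 'v \<Rightarrow> 'v \<Rightarrow> 'v \<Rightarrow> 4 \<Rightarrow> hpoint" where
  "net_cross X \<rho> z e f = (\<lambda>i.
     cross_vertex (quad_values \<rho> z e f i) (net_quad X z e f i)
                  (quad_values \<rho> z e f (i + 1)) (net_quad X z e f (i + 1)))"

definition crisscrossed_A_net ::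
    "'v::ab_group_add set \<Rightarrow> 'v set \<Rightarrow> ('v \<Rightarrow> real^3) \<Rightarrow> ('v \<Rightarrow> real) \<Rightarrow> bool" where
  "crisscrossed_A_net E D X \<rho> \<longleftrightarrow>
     A_net E D X \<and> (\<forall>z\<in>D. \<rho> z \<noteq> 0) \<and>
     (\<forall>z e f. elementary_quad E D z e f \<longrightarrow>
        adapted_cross (net_quad X z e f) (net_cross X \<rho> z e f))"

text \<open>
  Since \<open>e\<close> and \<open>f\<close> range over all ordered pairs of distinct unit vectors, this concerns all
  pairs of edge-adjacent elementary quadrilaterals within the 2-dimensional coordinate layers.
\<close>

definition C1_net ::
    "'v::ab_group_add set \<Rightarrow> 'v set \<Rightarrow> ('v \<Rightarrow> real^3) \<Rightarrow> ('v \<Rightarrow> real) \<Rightarrow> bool" where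
  "C1_net E D X \<rho> \<longleftrightarrow>
     (\<forall>z e f. elementary_quad E D z e f \<and> elementary_quad E D (z + e) e f \<longrightarrow>
        C1_along (inc {hom (X (z + e)), hom (X (z + e + f))})
          (net_quad X z e f) (net_cross X \<rho> z e f)
          (net_quad X (z + e) e f) (net_cross X \<rho> (z + e) e f))"

definition axes2 :: "(int \<times> int) set" where
  "axes2 = {(1, 0), (0, 1)}"

definition axes3 :: "((int \<times> int) \<times> int) set" where
  "axes3 = {((1, 0), 0), ((0, 1), 0), ((0, 0), 1)}"

definition layers :: "((int \<times> int) \<times> int) set" where
  "layers = UNIV \<times> {0, 1}"

definition two_layer ::
    "(int \<times> int \<Rightarrow> 'a) \<Rightarrow> (int \<times> int \<Rightarrow> 'a) \<Rightarrow> (int \<times> int) \<times> int \<Rightarrow> 'a" where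
  "two_layer F F' = (\<lambda>(z, k). if k = 0 then F z else F' z)"

definition A_surface :: "(int \<times> int \<Rightarrow> real^3) \<Rightarrow> bool" where
  "A_surface x \<longleftrightarrow> A_net axes2 UNIV x"

definition pre_hyperbolic :: "(int \<times> int \<Rightarrow> real^3) \<Rightarrow> (int \<times> int \<Rightarrow> real) \<Rightarrow> bool" where
  "pre_hyperbolic x \<rho> \<longleftrightarrow> crisscrossed_A_net axes2 UNIV x \<rho> \<and> C1_net axes2 UNIV x \<rho>"

text \<open>
  The last conjunct is the standing genericity assumption for the two-layer net, that is,
  skewness also of the vertical elementary quadrilaterals.
\<close>

definition discrete_Weingarten_pair ::
    "(int \<times> int \<Rightarrow> real^3) \<Rightarrow> (int \<times> int \<Rightarrow> real^3) \<Rightarrow> bool" where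
  "discrete_Weingarten_pair x x' \<longleftrightarrow>
     A_surface x \<and> A_surface x' \<and>
     (\<forall>z. inc {hom (x z), hom (x' z)} =
        vertex_plane axes2 UNIV x z \<inter> vertex_plane axes2 UNIV x' z) \<and>
     all_quads_skew axes3 layers (two_layer x x')"

definition Baecklund_pair ::
    "(int \<times> int \<Rightarrow> real^3) \<Rightarrow> (int \<times> int \<Rightarrow> real) \<Rightarrow>
     (int \<times> int \<Rightarrow> real^3) \<Rightarrow> (int \<times> int \<Rightarrow> real) \<Rightarrow> bool" where
  "Baecklund_pair x \<rho> x' \<rho>' \<longleftrightarrow>
     pre_hyperbolic x \<rho> \<and> pre_hyperbolic x' \<rho>' \<and> discrete_Weingarten_pair x x' \<and>
     crisscrossed_A_net axes3 layers (two_layer x x') (two_layer \<rho> \<rho>') \<and>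
     C1_net axes3 layers (two_layer x x') (two_layer \<rho> \<rho>')"

definition Weingarten_cube ::
    "(4 \<Rightarrow> hpoint) \<Rightarrow> (4 \<Rightarrow> hpoint) \<Rightarrow> (4 \<Rightarrow> hpoint) \<Rightarrow> (4 \<Rightarrow> hpoint) \<Rightarrow> bool" where
  "Weingarten_cube y p y' p' \<longleftrightarrow>
     skew_quad y \<and> skew_quad y' \<and>
     (\<forall>i. skew_quad (quadruple (y i) (y (i + 1)) (y' (i + 1)) (y' i))) \<and>
     (\<forall>i. hcoplanar {y i, y (i - 1), y (i + 1), y' i}) \<and>
     (\<forall>i. hcoplanar {y' i, y' (i - 1), y' (i + 1), y i}) \<and>
     adapted_cross y p \<and> adapted_cross y' p' \<and>
     (\<forall>i. inc {p i, p' i} =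
        inc {y i, y (i + 1), p (i + 2)} \<inter> inc {y' i, y' (i + 1), p' (i + 2)})"

definition Weingarten_cube_at ::
    "(int \<times> int \<Rightarrow> real^3) \<Rightarrow> (int \<times> int \<Rightarrow> real) \<Rightarrow>
     (int \<times> int \<Rightarrow> real^3) \<Rightarrow> (int \<times> int \<Rightarrow> real) \<Rightarrow> int \<times> int \<Rightarrow> bool" where
  "Weingarten_cube_at x \<rho> x' \<rho>' z \<longleftrightarrow>
     Weingarten_cube
       (net_quad x z (1, 0) (0, 1)) (net_cross x \<rho> z (1, 0) (0, 1))
       (net_quad x' z (1, 0) (0, 1)) (net_cross x' \<rho>' z (1, 0) (0, 1))"

definition Weingarten_pair ::
    "(int \<times> int \<Rightarrow> real^3) \<Rightarrow> (int \<times> int \<Rightarrow> real) \<Rightarrow>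
     (int \<times> int \<Rightarrow> real^3) \<Rightarrow> (int \<times> int \<Rightarrow> real) \<Rightarrow> bool" where
  "Weingarten_pair x \<rho> x' \<rho>' \<longleftrightarrow>
     pre_hyperbolic x \<rho> \<and> pre_hyperbolic x' \<rho>' \<and> discrete_Weingarten_pair x x' \<and>
     (\<forall>z. Weingarten_cube_at x \<rho> x' \<rho>' z)"

end

theory Submission imports Defs begin

text \<open>
  Put \<open>w z = \<rho> z *\<^sub>R hom (x z)\<close>. The cross vertex on an edge is then the sum of the two endpoints, so
  crosses are automatically coplanar, and every condition becomes linear: two pairs of vectors are
  proportional, with a common factor, modulo the span of an edge. For the quadrilaterals
  \<open>A B F D\<close> and \<open>B C H F\<close> the \<open>C\<^sup>1\<close>-condition reads
  \<open>C \<equiv> k A, H \<equiv> k D (mod B, F)\<close>, and the condition on a Weingarten cube over \<open>A B F D\<close> at its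
  edge \<open>A B\<close> reads \<open>A' \<equiv> k D, B' \<equiv> k F (mod A, B)\<close>, together with the same condition with the two
  layers exchanged.

  Given a Weingarten cube over \<open>A B F D\<close>, comparing coefficients with respect to the basis
  \<open>A, B, F, D\<close> shows that the vertical \<open>C\<^sup>1\<close>-condition at \<open>B B'\<close> is equivalent to the cube condition
  for \<open>B C H F\<close> at its edge \<open>B C\<close>. The condition at \<open>B F\<close> is inherited through the
  \<open>C\<^sup>1\<close>-condition, and the one at the last edge \<open>C H\<close> follows from the other three in both layers.
\<close>

section \<open>Linear algebra of quadruples of vectors\<close>

text \<open>Stated for a list rather than a set: a repeated vector counts as a dependence, and
  coefficients can be compared directly.\<close>

definition indep4 :: "'a::real_vector \<Rightarrow> 'a \<Rightarrow> 'a \<Rightarrow> 'a \<Rightarrow> bool" where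
  "indep4 a b c d \<longleftrightarrow> (\<forall>x y z t. x *\<^sub>R a + y *\<^sub>R b + z *\<^sub>R c + t *\<^sub>R d = 0 \<longrightarrow>
     x = 0 \<and> y = 0 \<and> z = 0 \<and> t = 0)"

lemma indep4_eqD:
  assumes "indep4 a b c d"
    and "x *\<^sub>R a + y *\<^sub>R b + z *\<^sub>R c + t *\<^sub>R d = x' *\<^sub>R a + y' *\<^sub>R b + z' *\<^sub>R c + t' *\<^sub>R d"
  shows "x = x'" "y = y'" "z = z'" "t = t'"
proof -
  have "(x - x') *\<^sub>R a + (y - y') *\<^sub>R b + (z - z') *\<^sub>R c + (t - t') *\<^sub>R d = 0"
    using assms(2) by (simp add: algebra_simps)
  then show "x = x'" "y = y'" "z = z'" "t = t'"
    using assms(1) unfolding indep4_def by (metis eq_iff_diff_eq_0)+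
qed

lemma indep4_rotate: "indep4 a b c d \<Longrightarrow> indep4 b c d a"
  unfolding indep4_def
proof (intro allI impI, goal_cases)
  case (1 x y z t)
  from 1(1)[rule_format, of t x y z] 1(2) show ?case by (simp add: ac_simps)
qed

lemma indep4_reflect: "indep4 a b c d \<Longrightarrow> indep4 b a d c"
  unfolding indep4_def
proof (intro allI impI, goal_cases)
  case (1 x y z t)
  from 1(1)[rule_format, of y x t z] 1(2) show ?case by (simp add: ac_simps)
qed

lemma in_span2: "v \<in> span {a, b} \<longleftrightarrow> (\<exists>x y. v = x *\<^sub>R a + y *\<^sub>R b)"
  for a :: "'a::real_vector"
  by (auto simp: span_breakdown_eq algebra_simps)

lemma in_span3: "v \<in> span {a, b, c} \<longleftrightarrow> (\<exists>x y z. v = x *\<^sub>R a + y *\<^sub>R b + z *\<^sub>R c)"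
  for a :: "'a::real_vector"
  by (auto simp: span_breakdown_eq algebra_simps)

text \<open>One factor \<open>k\<close> serves both pairs, with \<open>u\<close>, \<open>u'\<close>
  attached to \<open>a\<close> and \<open>v\<close>, \<open>v'\<close> to \<open>b\<close>. For
  weighted vertices this is the linear form of two quadrics having the same tangent planes along the
  line through \<open>a\<close> and \<open>b\<close>.\<close>

definition prop_mod :: "'a::real_vector \<Rightarrow> 'a \<Rightarrow> 'a \<Rightarrow> 'a \<Rightarrow> 'a \<Rightarrow> 'a \<Rightarrow> bool" where
  "prop_mod a b u v u' v' \<longleftrightarrow>
     (\<exists>k. k \<noteq> 0 \<and> u - k *\<^sub>R u' \<in> span {a, b} \<and> v - k *\<^sub>R v' \<in> span {a, b})"

lemma prop_modE:
  assumes "prop_mod a b u v u' v'"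
  obtains k x y x' y' where "k \<noteq> 0" "u = k *\<^sub>R u' + x *\<^sub>R a + y *\<^sub>R b"
    "v = k *\<^sub>R v' + x' *\<^sub>R a + y' *\<^sub>R b"
  using assms unfolding prop_mod_def in_span2 diff_eq_eq
  by (force simp: add.commute add.left_commute)

lemma prop_modI:
  assumes "k \<noteq> 0" "u = k *\<^sub>R u' + x *\<^sub>R a + y *\<^sub>R b" "v = k *\<^sub>R v' + x' *\<^sub>R a + y' *\<^sub>R b"
  shows "prop_mod a b u v u' v'"
  using assms unfolding prop_mod_def in_span2 diff_eq_eq
  by (force simp: add.commute add.left_commute)

lemma prop_mod_swap: "prop_mod a b u v u' v' \<Longrightarrow> prop_mod b a v u v' u'"
  unfolding prop_mod_def by (auto simp: insert_commute)

lemma prop_mod_sym: "prop_mod a b u v u' v' \<Longrightarrow> prop_mod a b u' v' u v"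
proof (elim prop_modE)
  fix k x y x' y' assume k: "k \<noteq> 0" and u: "u = k *\<^sub>R u' + x *\<^sub>R a + y *\<^sub>R b"
    and v: "v = k *\<^sub>R v' + x' *\<^sub>R a + y' *\<^sub>R b"
  show ?thesis
    by (rule prop_modI[of "1/k" _ _ "-x/k" _ "-y/k" _ _ _ "-x'/k" "-y'/k"])
      (use k in \<open>simp_all add: u v algebra_simps\<close>)
qed

lemma prop_mod_trans:
  assumes "prop_mod a b u v u' v'" "prop_mod a b u' v' u'' v''"
  shows "prop_mod a b u v u'' v''"
proof -
  from assms obtain k l where kl: "k \<noteq> 0" "l \<noteq> 0"
    and S: "u - k *\<^sub>R u' \<in> span {a, b}" "v - k *\<^sub>R v' \<in> span {a, b}"
      "u' - l *\<^sub>R u'' \<in> span {a, b}" "v' - l *\<^sub>R v'' \<in> span {a, b}"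
    unfolding prop_mod_def by blast
  have "u - k *\<^sub>R u' + k *\<^sub>R (u' - l *\<^sub>R u'') \<in> span {a, b}"
    "v - k *\<^sub>R v' + k *\<^sub>R (v' - l *\<^sub>R v'') \<in> span {a, b}"
    using S by (intro span_add span_scale; simp)+
  then show ?thesis using kl unfolding prop_mod_def
    by (intro exI[of _ "k * l"]) (simp add: algebra_simps)
qed

text \<open>The picture is two quadrilaterals \<open>A B F D\<close> and \<open>B C H F\<close>,
  with primes for the other layer. The coefficient of \<open>D\<close> in \<open>C'\<close> forces
  the factor \<open>y = \<gamma> * f / \<alpha>\<close>; eliminating \<open>A\<close> from
  \<open>B'\<close> by means of \<open>C\<close> leaves the same factor in front of
  \<open>F\<close>.\<close>

lemma prop_mod_side_edge:
  fixes A B C D F H A' B' C' F' :: "'a::real_vector"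
  assumes ind: "indep4 A B F D"
    and hor: "prop_mod B F C H A D"
    and com: "prop_mod B F B' F' A D"
    and side: "prop_mod A B A' B' D F"
    and ver: "prop_mod B B' C C' A A'"
    and C': "C' \<in> span {B, C, H}"
  shows "prop_mod B C B' C' F H"
proof -
  from hor obtain \<alpha> b1 f1 b2 f2 where \<alpha>: "\<alpha> \<noteq> 0"
    and C: "C = \<alpha> *\<^sub>R A + b1 *\<^sub>R B + f1 *\<^sub>R F" and H: "H = \<alpha> *\<^sub>R D + b2 *\<^sub>R B + f2 *\<^sub>R F"
    by (rule prop_modE)
  from com obtain a b3 f3 where B'1: "B' = a *\<^sub>R A + b3 *\<^sub>R B + f3 *\<^sub>R F"
    by (rule prop_modE)
  from side obtain f a4 b4 a5 b5 where f: "f \<noteq> 0"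
    and A': "A' = f *\<^sub>R D + a4 *\<^sub>R A + b4 *\<^sub>R B" and B'2: "B' = f *\<^sub>R F + a5 *\<^sub>R A + b5 *\<^sub>R B"
    by (rule prop_modE)
  from ver obtain \<gamma> b6 m b7 m7 where \<gamma>: "\<gamma> \<noteq> 0"
    and C2: "C = \<gamma> *\<^sub>R A + b6 *\<^sub>R B + m *\<^sub>R B'" and C'1: "C' = \<gamma> *\<^sub>R A' + b7 *\<^sub>R B + m7 *\<^sub>R B'"
    by (rule prop_modE)
  from C' obtain u v y where C'2: "C' = u *\<^sub>R B + v *\<^sub>R C + y *\<^sub>R H"
    unfolding in_span3 by blast
  have "a *\<^sub>R A + b3 *\<^sub>R B + f3 *\<^sub>R F + 0 *\<^sub>R D = a5 *\<^sub>R A + b5 *\<^sub>R B + f *\<^sub>R F + 0 *\<^sub>R D"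
    using B'1 B'2 by (simp add: algebra_simps)
  from indep4_eqD(3)[OF ind this] have f3: "f3 = f" .
  have "\<alpha> *\<^sub>R A + b1 *\<^sub>R B + f1 *\<^sub>R F + 0 *\<^sub>R D =
      (\<gamma> + m * a) *\<^sub>R A + (b6 + m * b3) *\<^sub>R B + (m * f) *\<^sub>R F + 0 *\<^sub>R D"
    using C C2 B'1 by (simp add: algebra_simps f3)
  from indep4_eqD[OF ind this] have e1: "\<alpha> = \<gamma> + m * a" "f1 = m * f" by auto
  have "(\<gamma> * a4 + m7 * a) *\<^sub>R A + (\<gamma> * b4 + b7 + m7 * b3) *\<^sub>R B + (m7 * f) *\<^sub>R F + (\<gamma> * f) *\<^sub>R D =
      (v * \<alpha>) *\<^sub>R A + (u + v * b1 + y * b2) *\<^sub>R B + (v * f1 + y * f2) *\<^sub>R F + (y * \<alpha>) *\<^sub>R D"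
    using C'1 C'2 unfolding A' B'1 f3 C H by (simp add: algebra_simps)
  \<comment> \<open>Only \<open>A'\<close> and \<open>H\<close> contribute to the coefficient of
    \<open>D\<close>.\<close>
  from indep4_eqD(4)[OF ind this] have e2: "\<gamma> * f = y * \<alpha>" .
  have y: "y = \<gamma> * f / \<alpha>" "y \<noteq> 0" using e2 \<alpha> \<gamma> f by (auto simp: field_simps)
  have "f = y + (a / \<alpha>) * f1"
    using \<alpha> by (simp add: y e1(2) field_simps) (simp add: e1 algebra_simps)
  then have "f *\<^sub>R F = y *\<^sub>R F + (a / \<alpha> * f1) *\<^sub>R F" by (metis scaleR_add_left)
  then have "B' = y *\<^sub>R F + (b3 - a / \<alpha> * b1) *\<^sub>R B + (a / \<alpha>) *\<^sub>R C"
    using \<alpha> by (simp add: B'1 f3 C algebra_simps)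
  moreover have "C' = y *\<^sub>R H + u *\<^sub>R B + v *\<^sub>R C" using C'2 by simp
  ultimately show ?thesis using y by (intro prop_modI[of y])
qed

text \<open>The reverse implication. For \<open>C\<close> and \<open>A\<close> the relation is read
  off from coefficients. For the primed pair, \<open>D\<close> cancels in the difference, which
  therefore lies in the vertex planes \<open>P\<close> at \<open>B\<close> and \<open>P'\<close> at
  \<open>B'\<close>, hence in \<open>span {B, B'}\<close>.\<close>

lemma prop_mod_vertical:
  fixes A B C D F H A' B' C' F' :: "'a::real_vector"
  assumes ind: "indep4 A B F D"
    and hor: "prop_mod B F C H A D"
    and com: "prop_mod B F B' F' A D"
    and side: "prop_mod A B A' B' D F"
    and side': "prop_mod B C B' C' F H"
    and P: "subspace P" "A \<in> P" "B \<in> P" "F \<in> P"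
    and P': "subspace P'" "A' \<in> P'" "C' \<in> P'"
    and PP': "P \<inter> P' \<subseteq> span {B, B'}"
  shows "prop_mod B B' C C' A A'"
proof -
  from hor obtain \<alpha> b1 f1 b2 f2 where \<alpha>: "\<alpha> \<noteq> 0"
    and C: "C = \<alpha> *\<^sub>R A + b1 *\<^sub>R B + f1 *\<^sub>R F" and H: "H = \<alpha> *\<^sub>R D + b2 *\<^sub>R B + f2 *\<^sub>R F"
    by (rule prop_modE)
  from com obtain a b3 f3 where B'1: "B' = a *\<^sub>R A + b3 *\<^sub>R B + f3 *\<^sub>R F"
    by (rule prop_modE)
  from side obtain f a4 b4 a5 b5 where f: "f \<noteq> 0"
    and A': "A' = f *\<^sub>R D + a4 *\<^sub>R A + b4 *\<^sub>R B" and B'2: "B' = f *\<^sub>R F + a5 *\<^sub>R A + b5 *\<^sub>R B"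
    by (rule prop_modE)
  from side' obtain t b6 c6 b7 c7 where t: "t \<noteq> 0"
    and B'3: "B' = t *\<^sub>R F + b6 *\<^sub>R B + c6 *\<^sub>R C" and C': "C' = t *\<^sub>R H + b7 *\<^sub>R B + c7 *\<^sub>R C"
    by (rule prop_modE)
  have "a *\<^sub>R A + b3 *\<^sub>R B + f3 *\<^sub>R F + 0 *\<^sub>R D = a5 *\<^sub>R A + b5 *\<^sub>R B + f *\<^sub>R F + 0 *\<^sub>R D"
    using B'1 B'2 by (simp add: algebra_simps)
  from indep4_eqD(3)[OF ind this] have f3: "f3 = f" .
  have "a *\<^sub>R A + b3 *\<^sub>R B + f *\<^sub>R F + 0 *\<^sub>R D =
      (c6 * \<alpha>) *\<^sub>R A + (b6 + c6 * b1) *\<^sub>R B + (t + c6 * f1) *\<^sub>R F + 0 *\<^sub>R D"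
    using B'1 B'3 by (simp add: C f3 algebra_simps)
  from indep4_eqD[OF ind this] have e: "a = c6 * \<alpha>" "f = t + c6 * f1" by auto
  \<comment> \<open>Chosen so that \<open>C'\<close> and \<open>\<gamma> *\<^sub>R A'\<close> have
    the same coefficient at \<open>D\<close>.\<close>
  define \<gamma> where "\<gamma> = \<alpha> * t / f"
  have \<gamma>: "\<gamma> \<noteq> 0" using \<alpha> t f by (simp add: \<gamma>_def)
  have "\<alpha> * f = \<alpha> * t + f1 * a" by (simp add: e algebra_simps)
  then have "\<alpha> = \<gamma> + f1 / f * a" using f by (simp add: \<gamma>_def field_simps)
  then have "\<alpha> *\<^sub>R A = \<gamma> *\<^sub>R A + (f1 / f * a) *\<^sub>R A" by (metis scaleR_add_left)
  then have "C = \<gamma> *\<^sub>R A + (b1 - f1 / f * b3) *\<^sub>R B + (f1 / f) *\<^sub>R B'"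
    using f by (simp add: C B'1 f3 algebra_simps)
  moreover have "C' - \<gamma> *\<^sub>R A' \<in> span {B, B'}"
  proof (rule subsetD[OF PP'], rule IntI)
    have "\<gamma> * f = t * \<alpha>" using f by (simp add: \<gamma>_def)
    then have "C' - \<gamma> *\<^sub>R A' = (c7 * \<alpha> - \<gamma> * a4) *\<^sub>R A +
        (t * b2 + b7 + c7 * b1 - \<gamma> * b4) *\<^sub>R B + (t * f2 + c7 * f1) *\<^sub>R F"
      by (simp add: C' A' H C algebra_simps)
    then show "C' - \<gamma> *\<^sub>R A' \<in> P"
      using P by (simp add: subspace_add subspace_scale)
    show "C' - \<gamma> *\<^sub>R A' \<in> P'"
      using P' by (simp add: subspace_diff subspace_scale)
  qed
  then obtain x y where "C' - \<gamma> *\<^sub>R A' = x *\<^sub>R B + y *\<^sub>R B'" unfolding in_span2 by blast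
  then have "C' = \<gamma> *\<^sub>R A' + x *\<^sub>R B + y *\<^sub>R B'" by (simp add: algebra_simps)
  ultimately show ?thesis using \<gamma> by (intro prop_modI)
qed

text \<open>Consecutive edges share \<open>v2\<close>: its coefficient at \<open>w3\<close> is the
  factor of the first edge, its coefficient at \<open>w1\<close> that of the second.\<close>

lemma two_prop_mods:
  assumes ind: "indep4 w1 w2 w3 w4"
    and "prop_mod w1 w2 v1 v2 w4 w3" "prop_mod w2 w3 v2 v3 w1 w4"
  obtains a b c where "a \<noteq> 0" "b \<noteq> 0" "v2 = b *\<^sub>R w1 + c *\<^sub>R w2 + a *\<^sub>R w3"
    "\<exists>x y. v1 = a *\<^sub>R w4 + x *\<^sub>R w1 + y *\<^sub>R w2" "\<exists>x y. v3 = b *\<^sub>R w4 + x *\<^sub>R w2 + y *\<^sub>R w3"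
proof -
  from assms(2) obtain a x y x' y' where a: "a \<noteq> 0" "v1 = a *\<^sub>R w4 + x *\<^sub>R w1 + y *\<^sub>R w2"
    and v2: "v2 = a *\<^sub>R w3 + x' *\<^sub>R w1 + y' *\<^sub>R w2" by (rule prop_modE)
  from assms(3) obtain b p q p' q' where b: "b \<noteq> 0" "v2 = b *\<^sub>R w1 + p *\<^sub>R w2 + q *\<^sub>R w3"
    "v3 = b *\<^sub>R w4 + p' *\<^sub>R w2 + q' *\<^sub>R w3" by (rule prop_modE)
  have "x' *\<^sub>R w1 + y' *\<^sub>R w2 + a *\<^sub>R w3 + 0 *\<^sub>R w4 = b *\<^sub>R w1 + p *\<^sub>R w2 + q *\<^sub>R w3 + 0 *\<^sub>R w4"
    using v2 b by (simp add: algebra_simps)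
  from indep4_eqD(3)[OF ind this] have "q = a" by simp
  with a b show ?thesis by (intro that) blast+
qed

text \<open>
  The edge conditions say that the matrices \<open>M\<close> and \<open>M'\<close> expressing \<open>v\<close> in \<open>w\<close> and \<open>w\<close> in \<open>v\<close> are
  cyclically tridiagonal with some coinciding entries; the remaining coincidence is read off
  from \<open>M' M = 1\<close>.
\<close>
lemma prop_mod_fourth_edge:
  fixes w1 w2 w3 w4 v1 v2 v3 v4 :: "'a::real_vector"
  assumes iw: "indep4 w1 w2 w3 w4" and iv: "indep4 v1 v2 v3 v4"
    and ivert: "indep4 w4 w1 v1 v4"
    and w: "prop_mod w1 w2 v1 v2 w4 w3" "prop_mod w2 w3 v2 v3 w1 w4" "prop_mod w3 w4 v3 v4 w2 w1"
    and v: "prop_mod v1 v2 w1 w2 v4 v3" "prop_mod v2 v3 w2 w3 v1 v4" "prop_mod v3 v4 w3 w4 v2 v1"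
  shows "prop_mod w4 w1 v4 v1 w3 w2"
proof -
  from two_prop_mods[OF iw w(1,2)] obtain a1 a2 c2 c1 b1 where n: "a1 \<noteq> 0" "a2 \<noteq> 0"
    and v1: "v1 = a1 *\<^sub>R w4 + c1 *\<^sub>R w1 + b1 *\<^sub>R w2" and v2: "v2 = a2 *\<^sub>R w1 + c2 *\<^sub>R w2 + a1 *\<^sub>R w3"
    and v3e: "\<exists>x y. v3 = a2 *\<^sub>R w4 + x *\<^sub>R w2 + y *\<^sub>R w3" by metis
  from two_prop_mods[OF indep4_rotate[OF iw] w(2,3)] obtain d2 a3 c3 c4 a4 where n3: "a3 \<noteq> 0"
    and v3: "v3 = a3 *\<^sub>R w2 + c3 *\<^sub>R w3 + d2 *\<^sub>R w4" and v4: "v4 = a3 *\<^sub>R w1 + a4 *\<^sub>R w3 + c4 *\<^sub>R w4"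
    by (metis add.assoc add.commute)
  \<comment> \<open>Both descriptions of \<open>v3\<close> have the factor of the edge
    \<open>w2 w3\<close> as coefficient of \<open>w4\<close>.\<close>
  from v3e obtain x y where "v3 = a2 *\<^sub>R w4 + x *\<^sub>R w2 + y *\<^sub>R w3" by blast
  with v3 have "0 *\<^sub>R w1 + a3 *\<^sub>R w2 + c3 *\<^sub>R w3 + d2 *\<^sub>R w4 = 0 *\<^sub>R w1 + x *\<^sub>R w2 + y *\<^sub>R w3 + a2 *\<^sub>R w4"
    by (simp add: algebra_simps)
  from indep4_eqD(4)[OF iw this] have d2: "d2 = a2" .
  from two_prop_mods[OF iv v(1,2)] obtain a1' a2' c2' where n': "a1' \<noteq> 0" "a2' \<noteq> 0"
    and w2: "w2 = a2' *\<^sub>R v1 + c2' *\<^sub>R v2 + a1' *\<^sub>R v3"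
    and w3e: "\<exists>x y. w3 = a2' *\<^sub>R v4 + x *\<^sub>R v2 + y *\<^sub>R v3" by metis
  from two_prop_mods[OF indep4_rotate[OF iv] v(2,3)] obtain d2' a3' c3' where n3': "a3' \<noteq> 0"
    and w3: "w3 = a3' *\<^sub>R v2 + c3' *\<^sub>R v3 + d2' *\<^sub>R v4" by metis
  from w3e obtain x y where "w3 = a2' *\<^sub>R v4 + x *\<^sub>R v2 + y *\<^sub>R v3" by blast
  with w3 have "0 *\<^sub>R v1 + a3' *\<^sub>R v2 + c3' *\<^sub>R v3 + d2' *\<^sub>R v4 = 0 *\<^sub>R v1 + x *\<^sub>R v2 + y *\<^sub>R v3 + a2' *\<^sub>R v4"
    by (simp add: algebra_simps)
  from indep4_eqD(4)[OF iv this] have d2': "d2' = a2'" .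
  \<comment> \<open>Expanding \<open>w2\<close>, and afterwards \<open>w3\<close>, first in
    \<open>v\<close> and then in \<open>w\<close> gives two rows of \<open>M' M = 1\<close>.\<close>
  have "0 *\<^sub>R w1 + 1 *\<^sub>R w2 + 0 *\<^sub>R w3 + 0 *\<^sub>R w4 =
      (a2' * c1 + c2' * a2) *\<^sub>R w1 + (a2' * b1 + c2' * c2 + a1' * a3) *\<^sub>R w2 +
      (c2' * a1 + a1' * c3) *\<^sub>R w3 + (a2' * a1 + a1' * a2) *\<^sub>R w4"
    by (subst w2, unfold v1 v2 v3 d2, simp add: algebra_simps)
  from indep4_eqD[OF iw this] have e2: "a2' * b1 + c2' * c2 + a1' * a3 = 1"
    "c2' * a1 + a1' * c3 = 0" "a2' * a1 + a1' * a2 = 0" by auto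
  have "0 *\<^sub>R w1 + 0 *\<^sub>R w2 + 1 *\<^sub>R w3 + 0 *\<^sub>R w4 =
      (a3' * a2 + a2' * a3) *\<^sub>R w1 + (a3' * c2 + c3' * a3) *\<^sub>R w2 +
      (a3' * a1 + c3' * c3 + a2' * a4) *\<^sub>R w3 + (c3' * a2 + a2' * c4) *\<^sub>R w4"
    by (subst w3, unfold v2 v3 v4 d2 d2', simp add: algebra_simps)
  from indep4_eqD[OF iw this] have e3: "a3' * a2 + a2' * a3 = 0" "a3' * c2 + c3' * a3 = 0"
    "a3' * a1 + c3' * c3 + a2' * a4 = 1" by auto
  have "a2 * (a1 * a3' - a1' * a3) = 0" using e2(3) e3(1) by algebra
  then have q: "a1 * a3' = a1' * a3" using n by simp
  \<comment> \<open>After multiplication by \<open>a1 * a3\<close>, the vanishing entries and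
    \<open>q\<close> make the \<open>c\<close> terms of the two diagonal equations agree, so only
    \<open>b1\<close> and \<open>a4\<close> remain to be compared.\<close>
  have "a1 * a3 * (a2' * b1 - a2' * a4) = 0" using e2 e3 q by algebra
  then have "a2' * b1 = a2' * a4" using n n3 by simp
  then have eq: "b1 = a4" using n' by simp
  \<comment> \<open>Otherwise \<open>v1\<close> would lie on the line through \<open>w4\<close> and
    \<open>w1\<close>, against skewness of the vertical face.\<close>
  have "b1 \<noteq> 0"
  proof
    assume "b1 = 0"
    then have "a1 *\<^sub>R w4 + c1 *\<^sub>R w1 + (- 1) *\<^sub>R v1 + 0 *\<^sub>R v4 = 0" by (simp add: v1)
    with ivert show False unfolding indep4_def by (metis zero_neq_neg_one)
  qed
  then show ?thesis
    by (rule prop_modI[of _ _ _ c4 _ a3 _ _ _ a1 c1]) (simp_all add: v1 v4 eq algebra_simps)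
qed

section \<open>Independence, dimension and spans\<close>

lemma not_in_spanD:
  fixes v :: "'a::real_vector"
  assumes "v \<notin> span S" "k *\<^sub>R v + u = 0" "u \<in> span S"
  shows "k = 0"
proof (rule ccontr)
  assume "k \<noteq> 0"
  have "k *\<^sub>R v = - u" using assms(2) by (simp add: eq_neg_iff_add_eq_0)
  then have "k *\<^sub>R v \<in> span S" using assms(3) by (simp add: span_neg)
  then have "(1 / k) *\<^sub>R k *\<^sub>R v \<in> span S" by (rule span_scale)
  with \<open>k \<noteq> 0\<close> assms(1) show False by simp
qed

text \<open>The right-hand side is the negation of \<open>hcoplanar\<close>; by
  \<open>dim_insert\<close> it says that no vector lies in the span of its successors.\<close>

lemma indep4_iff_dim: "indep4 a b c d \<longleftrightarrow> 3 < dim {a, b, c, d}"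
  for a :: "'a::euclidean_space"
proof
  assume ind: "indep4 a b c d"
  have "a \<notin> span {b, c, d}"
  proof
    assume "a \<in> span {b, c, d}"
    then obtain x y z where "a = x *\<^sub>R b + y *\<^sub>R c + z *\<^sub>R d" unfolding in_span3 by blast
    then have "1 *\<^sub>R a + 0 *\<^sub>R b + 0 *\<^sub>R c + 0 *\<^sub>R d = 0 *\<^sub>R a + x *\<^sub>R b + y *\<^sub>R c + z *\<^sub>R d" by simp
    from indep4_eqD(1)[OF ind this] show False by simp
  qed
  moreover have "b \<notin> span {c, d}"
  proof
    assume "b \<in> span {c, d}"
    then obtain y z where "b = y *\<^sub>R c + z *\<^sub>R d" unfolding in_span2 by blast
    then have "0 *\<^sub>R a + 1 *\<^sub>R b + 0 *\<^sub>R c + 0 *\<^sub>R d = 0 *\<^sub>R a + 0 *\<^sub>R b + y *\<^sub>R c + z *\<^sub>R d" by simp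
    from indep4_eqD(2)[OF ind this] show False by simp
  qed
  moreover have "c \<notin> span {d}"
  proof
    assume "c \<in> span {d}"
    then obtain z where "c = z *\<^sub>R d" by (auto simp: span_singleton)
    then have "0 *\<^sub>R a + 0 *\<^sub>R b + 1 *\<^sub>R c + 0 *\<^sub>R d = 0 *\<^sub>R a + 0 *\<^sub>R b + 0 *\<^sub>R c + z *\<^sub>R d" by simp
    from indep4_eqD(3)[OF ind this] show False by simp
  qed
  moreover have "d \<noteq> 0"
  proof
    assume "d = 0"
    then have "0 *\<^sub>R a + 0 *\<^sub>R b + 0 *\<^sub>R c + 1 *\<^sub>R d = 0 *\<^sub>R a + 0 *\<^sub>R b + 0 *\<^sub>R c + 0 *\<^sub>R d" by simp
    from indep4_eqD(4)[OF ind this] show False by simp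
  qed
  ultimately show "3 < dim {a, b, c, d}" by (simp add: dim_insert)
next
  assume "3 < dim {a, b, c, d}"
  then have n: "a \<notin> span {b, c, d}" "b \<notin> span {c, d}" "c \<notin> span {d}" "d \<notin> span {}"
    by (auto simp: dim_insert split: if_splits)
  show "indep4 a b c d"
    unfolding indep4_def
  proof (intro allI impI)
    fix x y z t
    assume *: "x *\<^sub>R a + y *\<^sub>R b + z *\<^sub>R c + t *\<^sub>R d = 0"
    have "x = 0" by (rule not_in_spanD[OF n(1), where u = "y *\<^sub>R b + z *\<^sub>R c + t *\<^sub>R d"])
        (use * in \<open>auto simp: in_span3 add.assoc\<close>)
    moreover have "y = 0" by (rule not_in_spanD[OF n(2), where u = "z *\<^sub>R c + t *\<^sub>R d"])
        (use * \<open>x = 0\<close> in \<open>auto simp: in_span2 add.assoc\<close>)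
    moreover have "z = 0" by (rule not_in_spanD[OF n(3), where u = "t *\<^sub>R d"])
        (use * \<open>x = 0\<close> \<open>y = 0\<close> in \<open>auto simp: span_singleton\<close>)
    ultimately show "x = 0 \<and> y = 0 \<and> z = 0 \<and> t = 0" using * n(4) by simp
  qed
qed

text \<open>Serves to recover a vertex plane from a vertex and two of its neighbours, three corners
  of a skew quadrilateral.\<close>

lemma plane_eq_span:
  fixes a :: "'a::euclidean_space"
  assumes "indep4 a b c d" "subspace P" "dim P = 3" "{a, b, c} \<subseteq> P"
  shows "P = span {a, b, c}"
proof -
  have "3 < dim {d, a, b, c}" using indep4_rotate[OF indep4_rotate[OF indep4_rotate[OF assms(1)]]]
    by (simp add: indep4_iff_dim)
  then have "3 \<le> dim {a, b, c}" by (simp add: dim_insert split: if_splits)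
  then show ?thesis
    using assms by (intro subspace_dim_equal[symmetric]) (auto simp: span_minimal)
qed

lemma indep4_spans:
  fixes a :: "'a::euclidean_space"
  assumes "indep4 a b c d" "DIM('a) = 4"
  shows "\<exists>x y z t. v = x *\<^sub>R a + y *\<^sub>R b + z *\<^sub>R c + t *\<^sub>R d"
proof -
  have "dim {a, b, c, d} = DIM('a)"
    using assms dim_subset_UNIV[of "{a, b, c, d}"] by (simp add: indep4_iff_dim)
  then have "v \<in> span {a, b, c, d}" using dim_eq_full by blast
  then show ?thesis by (simp add: span_breakdown_eq algebra_simps)
qed

lemma span_insert_scale:
  fixes a :: "'a::real_vector"
  assumes "r \<noteq> 0"
  shows "span (insert (r *\<^sub>R a) S) = span (insert a S)"
proof (intro span_eq[THEN iffD2] conjI)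
  show "insert (r *\<^sub>R a) S \<subseteq> span (insert a S)" by (auto intro: span_scale span_base)
  have "(1 / r) *\<^sub>R r *\<^sub>R a \<in> span (insert (r *\<^sub>R a) S)"
    by (intro span_scale span_base) simp
  with assms show "insert a S \<subseteq> span (insert (r *\<^sub>R a) S)" by (auto intro: span_base)
qed

lemma span_scale2:
  fixes a :: "'a::real_vector"
  assumes "r \<noteq> 0" "s \<noteq> 0"
  shows "span {r *\<^sub>R a, s *\<^sub>R b} = span {a, b}"
  using span_insert_scale[OF assms(1), of a "{s *\<^sub>R b}"] span_insert_scale[OF assms(2), of b "{a}"]
  by (simp add: insert_commute)

lemma span_scale3:
  fixes a :: "'a::real_vector"
  assumes "r \<noteq> 0" "s \<noteq> 0"
  shows "span {r *\<^sub>R a, s *\<^sub>R b, c} = span {a, b, c}"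
  using span_insert_scale[OF assms(1), of a "{s *\<^sub>R b, c}"]
    span_insert_scale[OF assms(2), of b "{a, c}"]
  by (simp add: insert_commute)

text \<open>The condition on a Weingarten cube at one edge, with \<open>a + b\<close> and
  \<open>c + d\<close> as cross vertices on opposite edges of \<open>a b c d\<close>. Planar stars
  keep \<open>c\<close> out of \<open>a'\<close> and \<open>d\<close> out of \<open>b'\<close>, so
  \<open>a' + b'\<close> lies in the plane through \<open>a\<close>, \<open>b\<close>,
  \<open>c + d\<close> only if the coefficient of \<open>d\<close> in \<open>a'\<close> equals that
  of \<open>c\<close> in \<open>b'\<close>.\<close>

lemma prop_mod_iff_span_Int:
  fixes a b c d a' b' c' d' :: "'a::real_vector"
  assumes i: "indep4 a b c d" and i': "indep4 a' b' c' d'" and v: "indep4 a b b' a'"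
    and pl: "a' \<in> span {d, a, b}" "b' \<in> span {a, b, c}" "a \<in> span {d', a', b'}" "b \<in> span {a', b', c'}"
  shows "span {a + b, a' + b'} = span {a, b, c + d} \<inter> span {a', b', c' + d'} \<longleftrightarrow>
    prop_mod a b a' b' d c \<and> prop_mod a' b' a b d' c'"
proof
  have aux: "prop_mod a b a' b' d c"
    if i: "indep4 a b c d" and v: "indep4 a b b' a'" and pl: "a' \<in> span {d, a, b}" "b' \<in> span {a, b, c}"
      and mem: "a' + b' \<in> span {a, b, c + d}" for a b c d a' b' :: 'a
  proof -
    from pl(1) obtain k x y where a': "a' = k *\<^sub>R d + x *\<^sub>R a + y *\<^sub>R b" unfolding in_span3 by blast
    from pl(2) obtain l x' y' where b': "b' = x' *\<^sub>R a + y' *\<^sub>R b + l *\<^sub>R c" unfolding in_span3 by blast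
    from mem obtain p q r where "a' + b' = p *\<^sub>R a + q *\<^sub>R b + r *\<^sub>R (c + d)" unfolding in_span3 by blast
    then have "(x + x') *\<^sub>R a + (y + y') *\<^sub>R b + l *\<^sub>R c + k *\<^sub>R d = p *\<^sub>R a + q *\<^sub>R b + r *\<^sub>R c + r *\<^sub>R d"
      by (simp add: a' b' algebra_simps)
    from indep4_eqD[OF i this] have kl: "l = k" by simp
    \<comment> \<open>A vanishing factor would put \<open>a'\<close> on the line through
      \<open>a\<close> and \<open>b\<close>.\<close>
    have "k \<noteq> 0"
    proof
      assume "k = 0"
      then have "x *\<^sub>R a + y *\<^sub>R b + 0 *\<^sub>R b' + 0 *\<^sub>R a' = 0 *\<^sub>R a + 0 *\<^sub>R b + 0 *\<^sub>R b' + 1 *\<^sub>R a'" by (simp add: a')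
      from indep4_eqD(4)[OF v this] show False by simp
    qed
    then show ?thesis by (rule prop_modI[OF _ a', of b' c x' y']) (simp add: b' kl)
  qed
  assume eq: "span {a + b, a' + b'} = span {a, b, c + d} \<inter> span {a', b', c' + d'}"
  have "a + b \<in> span {a + b, a' + b'}" "a' + b' \<in> span {a + b, a' + b'}" by (auto intro: span_base)
  then have "a' + b' \<in> span {a, b, c + d}" "a + b \<in> span {a', b', c' + d'}" unfolding eq by auto
  moreover have "indep4 a' b' b a"
    by (rule indep4_rotate[OF indep4_rotate[OF indep4_reflect[OF v]]])
  ultimately show "prop_mod a b a' b' d c \<and> prop_mod a' b' a b d' c'"
    using aux[of a b c d b' a'] aux[of a' b' c' d' b a] i i' v pl by blast
next
  assume pm: "prop_mod a b a' b' d c \<and> prop_mod a' b' a b d' c'"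
  \<comment> \<open>The third generator can be exchanged for the cross vertex of the other layer.
    Two planes of this form meet in the line joining the cross vertices because the vertical face is
    skew.\<close>
  have aux: "span {a, b, c + d} = span {a, b, a' + b'}"
    if "prop_mod a b a' b' d c" for a b c d a' b' :: 'a
  proof -
    from that obtain k x y x' y' where k: "k \<noteq> 0" and a': "a' = k *\<^sub>R d + x *\<^sub>R a + y *\<^sub>R b"
      and b': "b' = k *\<^sub>R c + x' *\<^sub>R a + y' *\<^sub>R b" by (rule prop_modE)
    have 1: "a' + b' = (x + x') *\<^sub>R a + (y + y') *\<^sub>R b + k *\<^sub>R (c + d)"
      by (simp add: a' b' algebra_simps)
    then have "k *\<^sub>R (c + d) = (a' + b') - (x + x') *\<^sub>R a - (y + y') *\<^sub>R b" by simp
    then have "(1 / k) *\<^sub>R k *\<^sub>R (c + d) = (1 / k) *\<^sub>R ((a' + b') - (x + x') *\<^sub>R a - (y + y') *\<^sub>R b)"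
      by (rule arg_cong)
    then have 2: "c + d = (1 / k) *\<^sub>R ((a' + b') - (x + x') *\<^sub>R a - (y + y') *\<^sub>R b)"
      using k by simp
    have "c + d \<in> span {a, b, a' + b'}" unfolding 2
      by (intro span_scale span_diff span_base) auto
    moreover have "a' + b' \<in> span {a, b, c + d}" unfolding 1
      by (intro span_add span_scale span_base) auto
    ultimately show ?thesis by (intro span_eq[THEN iffD2]) (auto intro: span_base)
  qed
  have "span {a, b, a' + b'} \<inter> span {a', b', a + b} = span {a + b, a' + b'}"
  proof
    show "span {a + b, a' + b'} \<subseteq> span {a, b, a' + b'} \<inter> span {a', b', a + b}"
      by (intro Int_greatest span_minimal) (auto intro: span_base span_add)
    show "span {a, b, a' + b'} \<inter> span {a', b', a + b} \<subseteq> span {a + b, a' + b'}"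
    proof
      fix u assume "u \<in> span {a, b, a' + b'} \<inter> span {a', b', a + b}"
      then have "u \<in> span {a, b, a' + b'}" "u \<in> span {a', b', a + b}" by auto
      then obtain x y z x' y' z' where 1: "u = x *\<^sub>R a + y *\<^sub>R b + z *\<^sub>R (a' + b')"
        and 2: "u = x' *\<^sub>R a' + y' *\<^sub>R b' + z' *\<^sub>R (a + b)" unfolding in_span3 by blast
      then have "x *\<^sub>R a + y *\<^sub>R b + z *\<^sub>R b' + z *\<^sub>R a' = z' *\<^sub>R a + z' *\<^sub>R b + y' *\<^sub>R b' + x' *\<^sub>R a'"
        by (simp add: algebra_simps)
      from indep4_eqD[OF v this] have "u = z' *\<^sub>R (a + b) + z *\<^sub>R (a' + b')"
        using 1 by (simp add: algebra_simps)
      then show "u \<in> span {a + b, a' + b'}" unfolding in_span2 by blast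
    qed
  qed
  then show "span {a + b, a' + b'} = span {a, b, c + d} \<inter> span {a', b', c' + d'}"
    using aux[of a b a' b' d c] aux[of a' b' a b d' c'] pm by simp
qed

lemma indep4_scale:
  assumes "r \<noteq> 0" "s \<noteq> 0" "t \<noteq> 0" "u \<noteq> 0" "indep4 a b c d"
  shows "indep4 (r *\<^sub>R a) (s *\<^sub>R b) (t *\<^sub>R c) (u *\<^sub>R d)"
  unfolding indep4_def
proof (intro allI impI)
  fix x y z v
  assume "x *\<^sub>R r *\<^sub>R a + y *\<^sub>R s *\<^sub>R b + z *\<^sub>R t *\<^sub>R c + v *\<^sub>R u *\<^sub>R d = 0"
  then have "(x * r) *\<^sub>R a + (y * s) *\<^sub>R b + (z * t) *\<^sub>R c + (v * u) *\<^sub>R d = 0" by simp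
  with assms show "x = 0 \<and> y = 0 \<and> z = 0 \<and> v = 0" unfolding indep4_def by fastforce
qed

section \<open>Crosses and hyperboloids\<close>

declare split_paired_All [simp del] split_paired_Ex [simp del]

text \<open>Polarization: the value at \<open>u + v\<close> yields the mixed term.\<close>

lemma isotropic_span2_iff:
  assumes B: "bilinear B" and sym: "\<And>u v. B u v = B v u"
  shows "span {u, v} \<subseteq> {x. B x x = 0} \<longleftrightarrow> B u u = 0 \<and> B v v = 0 \<and> B u v = (0::real)"
proof
  assume *: "span {u, v} \<subseteq> {x. B x x = 0}"
  have "u \<in> span {u, v}" "v \<in> span {u, v}" "u + v \<in> span {u, v}"
    by (auto intro: span_base span_add)
  with * have "B u u = 0" "B v v = 0" "B (u + v) (u + v) = 0" by auto
  then show "B u u = 0 \<and> B v v = 0 \<and> B u v = 0"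
    by (simp add: bilinear_ladd[OF B] bilinear_radd[OF B] sym[of v u])
next
  assume "B u u = 0 \<and> B v v = 0 \<and> B u v = 0"
  then show "span {u, v} \<subseteq> {x. B x x = 0}"
    by (auto simp: in_span2 bilinear_ladd[OF B] bilinear_radd[OF B] bilinear_lmul[OF B]
        bilinear_rmul[OF B] sym[of v u])
qed

text \<open>Normal forms for sums in the type of integers modulo 4, matching \<open>forall_4\<close>.\<close>
lemma index4: "(5::4) = 1" "(6::4) = 2" "(7::4) = 3" "(0::4) = 4"
  by simp_all

text \<open>The edge lines annihilate all products of equal or adjacent vertices. Each of the two
  cross lines then contributes the same single equation between the two diagonal products.\<close>

lemma hyperboloid_iff:
  assumes w: "\<And>i. w i = r i *\<^sub>R y i" "\<And>i. r i \<noteq> 0" and p: "\<And>i. p i = w i + w (i + 1)"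
  shows "hyperboloid y p B \<longleftrightarrow>
     bilinear B \<and> (\<forall>u v. B u v = B v u) \<and> (\<forall>u. (\<forall>v. B u v = 0) \<longrightarrow> u = 0) \<and>
     (\<forall>i. B (w i) (w i) = 0 \<and> B (w i) (w (i + 1)) = 0) \<and> B (w 1) (w 3) = - B (w 2) (w 4)"
proof -
  have s: "span {y i, y (i + 1)} = span {w i, w (i + 1)}" for i
    by (simp add: w span_scale2)
  show ?thesis
  proof (cases "bilinear B \<and> (\<forall>u v. B u v = B v u)")
    case True
    then have B: "bilinear B" and sym: "\<And>u v. B u v = B v u" by auto
    note iso = isotropic_span2_iff[OF B sym]
    have 1: "(\<forall>i. inc {y i, y (i + 1)} \<subseteq> {v. B v v = 0}) \<longleftrightarrow>
        (\<forall>i. B (w i) (w i) = 0 \<and> B (w i) (w (i + 1)) = 0)"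
      by (auto simp: s iso)
    have 2: "(\<forall>i. inc {p i, p (i + 2)} \<subseteq> {v. B v v = 0}) \<longleftrightarrow> B (w 1) (w 3) = - B (w 2) (w 4)"
      if "\<forall>i. B (w i) (w i) = 0 \<and> B (w i) (w (i + 1)) = 0"
      using that sym[of "w 2" "w 1"] sym[of "w 3" "w 2"] sym[of "w 4" "w 3"] sym[of "w 1" "w 4"]
        sym[of "w 3" "w 1"] sym[of "w 4" "w 2"]
      by (auto simp: forall_4 index4(1-3) iso p bilinear_ladd[OF B] bilinear_radd[OF B])
    show ?thesis unfolding hyperboloid_def using 1 2 by blast
  next
    case False
    then show ?thesis unfolding hyperboloid_def by blast
  qed
qed

lemma hyperboloid_exists:
  fixes w :: "4 \<Rightarrow> hpoint"
  assumes w: "\<And>i. w i = r i *\<^sub>R y i" "\<And>i. r i \<noteq> 0" and p: "\<And>i. p i = w i + w (i + 1)"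
    and ind: "indep4 (w 1) (w 2) (w 3) (w 4)"
  obtains B where "hyperboloid y p B" "B (w 1) (w 3) = 1"
proof -
  have D: "DIM(hpoint) = 4" by simp
  from indep4_spans[OF ind D] obtain c1 c2 c3 c4 where
    c: "v = c1 v *\<^sub>R w 1 + c2 v *\<^sub>R w 2 + c3 v *\<^sub>R w 3 + c4 v *\<^sub>R w 4" for v by metis
  \<comment> \<open>Linearity of the coordinate functions comes from uniqueness of the
    coefficients.\<close>
  have uniq: "c1 v = x \<and> c2 v = y \<and> c3 v = z \<and> c4 v = t"
    if "v = x *\<^sub>R w 1 + y *\<^sub>R w 2 + z *\<^sub>R w 3 + t *\<^sub>R w 4" for v x y z t
    using indep4_eqD[OF ind] that c[of v] by metis
  have add: "c1 (u + v) = c1 u + c1 v \<and> c2 (u + v) = c2 u + c2 v \<and> c3 (u + v) = c3 u + c3 v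
      \<and> c4 (u + v) = c4 u + c4 v" for u v
    by (rule uniq) (subst c[of u], subst c[of v], simp add: algebra_simps)
  have scale: "c1 (k *\<^sub>R v) = k * c1 v \<and> c2 (k *\<^sub>R v) = k * c2 v \<and> c3 (k *\<^sub>R v) = k * c3 v
      \<and> c4 (k *\<^sub>R v) = k * c4 v" for k v
    by (rule uniq) (subst c[of v], simp add: algebra_simps)
  have e: "c1 (w 1) = 1 \<and> c2 (w 1) = 0 \<and> c3 (w 1) = 0 \<and> c4 (w 1) = 0" "c1 (w 2) = 0 \<and> c2 (w 2) = 1 \<and> c3 (w 2) = 0 \<and> c4 (w 2) = 0"
    "c1 (w 3) = 0 \<and> c2 (w 3) = 0 \<and> c3 (w 3) = 1 \<and> c4 (w 3) = 0" "c1 (w 4) = 0 \<and> c2 (w 4) = 0 \<and> c3 (w 4) = 0 \<and> c4 (w 4) = 1"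
    by (rule uniq; simp)+
  \<comment> \<open>The quadric \<open>x1 * x3 = x2 * x4\<close> in these coordinates, scaled so
    that \<open>B (w 1) (w 3) = 1\<close>.\<close>
  define B where "B u v = c1 u * c3 v + c3 u * c1 v - c2 u * c4 v - c4 u * c2 v" for u v
  have bil: "bilinear B"
    unfolding bilinear_def by (intro conjI allI linearI; simp add: B_def add scale algebra_simps)
  have nondeg: "u = 0" if "\<And>v. B u v = 0" for u
    using that[of "w 1"] that[of "w 2"] that[of "w 3"] that[of "w 4"]
    by (subst c[of u]) (simp add: B_def e)
  have sym: "B u v = B v u" for u v by (simp add: B_def)
  have "hyperboloid y p B"
    unfolding hyperboloid_iff[where w = w and r = r, OF w p] forall_4
    using bil nondeg sym by (auto simp: index4(1-3) B_def e)
  then show ?thesis by (rule that) (simp add: B_def e)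
qed

text \<open>Vertices 2 and 3 of the first quadrilateral are vertices 1 and 4 of the second. Both
  forms are computed explicitly along this edge; equal tangent planes at its endpoints and its cross
  vertex already give the proportionality, and the latter makes the forms proportional along the
  whole edge.\<close>

lemma C1_along_iff:
  assumes w: "\<And>i. w i = r i *\<^sub>R y i" "\<And>i. r i \<noteq> 0" and p: "\<And>i. p i = w i + w (i + 1)"
    and v: "\<And>i. v i = s i *\<^sub>R y' i" "\<And>i. s i \<noteq> 0" and p': "\<And>i. p' i = v i + v (i + 1)"
    and common: "v 1 = w 2" "v 4 = w 3"
    and iw: "indep4 (w 1) (w 2) (w 3) (w 4)" and iv: "indep4 (v 1) (v 2) (v 3) (v 4)"
  shows "C1_along (inc {y 2, y 3}) y p y' p' \<longleftrightarrow> prop_mod (w 2) (w 3) (v 2) (v 3) (w 1) (w 4)"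
proof -
  have l: "inc {y 2, y 3} = inc {w 2, w 3}" by (simp add: w span_scale2)
  have D: "DIM(hpoint) = 4" by simp
  note hyp = hyperboloid_iff[where w = w and r = r, OF w p] hyperboloid_iff[where w = v and r = s, OF v p']
  \<comment> \<open>With first argument on the common edge, each form depends only on the
    coefficients at the two vertices off that edge, up to a scalar.\<close>
  have form: "B (a *\<^sub>R w 2 + b *\<^sub>R w 3) (c1 *\<^sub>R w 1 + c2 *\<^sub>R w 2 + c3 *\<^sub>R w 3 + c4 *\<^sub>R w 4) =
      (b * c1 - a * c4) * B (w 1) (w 3)" if "hyperboloid y p B" for B a b c1 c2 c3 c4
  proof -
    from that have B: "bilinear B" and sym: "\<And>u v. B u v = B v u"
      and e: "\<forall>i. B (w i) (w i) = 0 \<and> B (w i) (w (i + 1)) = 0" "B (w 2) (w 4) = - B (w 1) (w 3)"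
      unfolding hyp by auto
    show ?thesis
      using e sym[of "w 2" "w 1"] sym[of "w 3" "w 2"] sym[of "w 3" "w 1"]
      by (simp add: forall_4 index4(1-3) bilinear_ladd[OF B] bilinear_radd[OF B] bilinear_lmul[OF B]
          bilinear_rmul[OF B] algebra_simps)
  qed
  have form': "B (a *\<^sub>R w 2 + b *\<^sub>R w 3) (d1 *\<^sub>R w 2 + d2 *\<^sub>R v 2 + d3 *\<^sub>R v 3 + d4 *\<^sub>R w 3) =
      (a * d3 - b * d2) * B (v 1) (v 3)" if "hyperboloid y' p' B" for B a b d1 d2 d3 d4
  proof -
    from that have B: "bilinear B" and sym: "\<And>u v. B u v = B v u"
      and e: "\<forall>i. B (v i) (v i) = 0 \<and> B (v i) (v (i + 1)) = 0" "B (v 2) (v 4) = - B (v 1) (v 3)"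
      unfolding hyp by auto
    show ?thesis
      using e sym[of "v 2" "v 1"] sym[of "v 3" "v 2"] sym[of "v 3" "v 1"] sym[of "v 4" "v 3"]
        sym[of "v 1" "v 4"] sym[of "v 4" "v 2"]
      by (simp add: forall_4 index4(1-3) common[symmetric] bilinear_ladd[OF B] bilinear_radd[OF B]
          bilinear_lmul[OF B] bilinear_rmul[OF B] algebra_simps)
  qed
  show ?thesis
  proof
    assume "C1_along (inc {y 2, y 3}) y p y' p'"
    then obtain B B' where h: "hyperboloid y p B" "hyperboloid y' p' B'"
      and t: "\<And>u. u \<in> inc {w 2, w 3} - {0} \<Longrightarrow> tangent_plane B u = tangent_plane B' u"
      unfolding C1_along_def l by blast
    \<comment> \<open>Otherwise \<open>w 2\<close> would be in the radical of a nondegenerate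
      form.\<close>
    have B13: "B (w 1) (w 3) \<noteq> 0"
    proof
      assume "B (w 1) (w 3) = 0"
      then have "B (w 2) x = 0" for x
        using indep4_spans[OF iw D, of x] form[OF h(1), of 1 0] by force
      with h(1) have "w 2 = 0" unfolding hyp by blast
      with iw show False unfolding indep4_def by (metis add_0_left scaleR_zero_left scaleR_zero_right zero_neq_one)
    qed
    have ne: "a *\<^sub>R w 2 + b *\<^sub>R w 3 \<noteq> 0" if "a \<noteq> 0 \<or> b \<noteq> 0" for a b
      using indep4_eqD(2,3)[OF iw, of 0 a b 0 0 0 0 0] that by auto
    have tan: "b * c1 - a * c4 = 0 \<longleftrightarrow> (a * d3 - b * d2) * B' (v 1) (v 3) = 0"
      if "c1 *\<^sub>R w 1 + c2 *\<^sub>R w 2 + c3 *\<^sub>R w 3 + c4 *\<^sub>R w 4 = d1 *\<^sub>R w 2 + d2 *\<^sub>R v 2 + d3 *\<^sub>R v 3 + d4 *\<^sub>R w 3"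
        "a \<noteq> 0 \<or> b \<noteq> 0" for a b c1 c2 c3 c4 d1 d2 d3 d4
    proof -
      have "a *\<^sub>R w 2 + b *\<^sub>R w 3 \<in> inc {w 2, w 3} - {0}" using ne[OF that(2)] by (auto simp: in_span2)
      from t[OF this] have "B (a *\<^sub>R w 2 + b *\<^sub>R w 3) q = 0 \<longleftrightarrow> B' (a *\<^sub>R w 2 + b *\<^sub>R w 3) q = 0" for q
        unfolding tangent_plane_def by blast
      from this[of "c1 *\<^sub>R w 1 + c2 *\<^sub>R w 2 + c3 *\<^sub>R w 3 + c4 *\<^sub>R w 4"] show ?thesis
        unfolding form[OF h(1)] unfolding that(1) form'[OF h(2)] using B13 by simp
    qed
    from indep4_spans[OF iw D, of "v 2"] obtain c1 c2 c3 c4 where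
      v2: "v 2 = c1 *\<^sub>R w 1 + c2 *\<^sub>R w 2 + c3 *\<^sub>R w 3 + c4 *\<^sub>R w 4" by blast
    from indep4_spans[OF iw D, of "v 3"] obtain e1 e2 e3 e4 where
      v3: "v 3 = e1 *\<^sub>R w 1 + e2 *\<^sub>R w 2 + e3 *\<^sub>R w 3 + e4 *\<^sub>R w 4" by blast
    \<comment> \<open>The edges \<open>w 2\<close>, \<open>v 2\<close> and \<open>w 3\<close>,
      \<open>v 3\<close> are lines of the second quadric, so \<open>v 2\<close> and
      \<open>v 3\<close> lie in its tangent planes at \<open>w 2\<close> and
      \<open>w 3\<close>.\<close>
    have c4: "c4 = 0" using tan[of c1 c2 c3 c4 0 1 0 0 1 0] v2 by simp
    have e1: "e1 = 0" using tan[of e1 e2 e3 e4 0 0 1 0 0 1] v3 by simp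
    have "(c1 + e1) *\<^sub>R w 1 + (c2 + e2) *\<^sub>R w 2 + (c3 + e3) *\<^sub>R w 3 + (c4 + e4) *\<^sub>R w 4 =
        0 *\<^sub>R w 2 + 1 *\<^sub>R v 2 + 1 *\<^sub>R v 3 + 0 *\<^sub>R w 3"
      by (simp add: v2 v3 algebra_simps)
    \<comment> \<open>At the cross vertex \<open>w 2 + w 3\<close> the tangent plane contains
      \<open>v 2 + v 3\<close>, which equates the two factors.\<close>
    from tan[OF this, of 1 1] have eq: "e4 = c1" by (simp add: c4 e1)
    have "c1 \<noteq> 0"
    proof
      assume "c1 = 0"
      then have "c2 *\<^sub>R v 1 + (- 1) *\<^sub>R v 2 + 0 *\<^sub>R v 3 + c3 *\<^sub>R v 4 = 0"
        by (simp add: v2 c4 common)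
      with iv show False unfolding indep4_def by (metis zero_neq_neg_one)
    qed
    then show "prop_mod (w 2) (w 3) (v 2) (v 3) (w 1) (w 4)"
      by (rule prop_modI[of _ _ _ c2 _ c3 _ _ _ e2 e3]) (simp_all add: v2 v3 c4 e1 eq)
  next
    assume "prop_mod (w 2) (w 3) (v 2) (v 3) (w 1) (w 4)"
    then obtain k x z x' z' where k: "k \<noteq> 0" and v2: "v 2 = k *\<^sub>R w 1 + x *\<^sub>R w 2 + z *\<^sub>R w 3"
      and v3: "v 3 = k *\<^sub>R w 4 + x' *\<^sub>R w 2 + z' *\<^sub>R w 3" by (rule prop_modE)
    obtain B where B: "hyperboloid y p B" "B (w 1) (w 3) = 1"
      by (rule hyperboloid_exists[where w = w and r = r, OF w p iw])
    obtain B' where B': "hyperboloid y' p' B'" "B' (v 1) (v 3) = 1"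
      by (rule hyperboloid_exists[where w = v and r = s, OF v p' iv])
    \<comment> \<open>The factor \<open>- k\<close> depends on both forms being scaled to the value
      1 on the diagonal from vertex 1 to vertex 3.\<close>
    have "B u q = - k * B' u q" if "u \<in> inc {w 2, w 3}" for u q
    proof -
      from that obtain a b where u: "u = a *\<^sub>R w 2 + b *\<^sub>R w 3" unfolding in_span2 by blast
      from indep4_spans[OF iv D, of q] obtain d1 d2 d3 d4 where
        q: "q = d1 *\<^sub>R w 2 + d2 *\<^sub>R v 2 + d3 *\<^sub>R v 3 + d4 *\<^sub>R w 3" unfolding common by blast
      then have q': "q = (d2 * k) *\<^sub>R w 1 + (d1 + d2 * x + d3 * x') *\<^sub>R w 2 +
          (d4 + d2 * z + d3 * z') *\<^sub>R w 3 + (d3 * k) *\<^sub>R w 4"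
        by (simp add: v2 v3 algebra_simps)
      have "B u q = (b * (d2 * k) - a * (d3 * k)) * 1"
        unfolding u q' using form[OF B(1)] B(2) by metis
      moreover have "B' u q = (a * d3 - b * d2) * 1"
        unfolding u q using form'[OF B'(1)] B'(2) by metis
      ultimately show ?thesis by algebra
    qed
    then have "tangent_plane B u = tangent_plane B' u" if "u \<in> inc {w 2, w 3}" for u
      using that k unfolding tangent_plane_def by auto
    with B(1) B'(1) show "C1_along (inc {y 2, y 3}) y p y' p'"
      unfolding C1_along_def l by blast
  qed
qed

lemma skew_quad_iff: "skew_quad y \<longleftrightarrow> indep4 (y 1) (y 2) (y 3) (y 4)"
  by (simp add: skew_quad_def hcoplanar_def UNIV_4 indep4_iff_dim not_le)

lemma quadruple_simps [simp]:
  "quadruple a b c d 1 = a" "quadruple a b c d 2 = b" "quadruple a b c d 3 = c"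
  "quadruple a b c d 4 = d" "quadruple a b c d 0 = d"
  by (simp_all add: quadruple_def)

text \<open>Coplanarity holds because the alternating sum of the four cross vertices telescopes to
  zero.\<close>

lemma adapted_cross_weighted:
  assumes skew: "skew_quad y" and r: "\<And>i. r i \<noteq> 0"
    and p: "\<And>i. p i = r i *\<^sub>R y i + r (i + 1) *\<^sub>R y (i + 1)"
  shows "adapted_cross y p"
proof -
  have nin: "x *\<^sub>R a + z *\<^sub>R b \<notin> span {a} \<and> x *\<^sub>R a + z *\<^sub>R b \<notin> span {b}"
    if ind: "indep4 a b c d" and nz: "x \<noteq> 0" "z \<noteq> 0" for x z and a b c d :: hpoint
  proof -
    have "x *\<^sub>R a + z *\<^sub>R b + 0 *\<^sub>R c + 0 *\<^sub>R d \<noteq> k *\<^sub>R a + 0 *\<^sub>R b + 0 *\<^sub>R c + 0 *\<^sub>R d"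
      "x *\<^sub>R a + z *\<^sub>R b + 0 *\<^sub>R c + 0 *\<^sub>R d \<noteq> 0 *\<^sub>R a + k *\<^sub>R b + 0 *\<^sub>R c + 0 *\<^sub>R d" for k
      using indep4_eqD(1,2)[OF ind] nz by blast+
    then show ?thesis by (simp add: span_singleton image_iff)
  qed
  have i: "indep4 (y 1) (y 2) (y 3) (y 4)" using skew by (simp add: skew_quad_iff)
  note rot = indep4_rotate[OF i]
  have "\<forall>i. p i \<notin> span {y i} \<and> p i \<notin> span {y (i + 1)}"
    unfolding forall_4
    using nin[OF i r r, of 1 2] nin[OF rot r r, of 2 3] nin[OF indep4_rotate[OF rot] r r, of 3 4]
      nin[OF indep4_rotate[OF indep4_rotate[OF rot]] r r, of 4 1]
    by (simp add: p index4(1-3))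
  moreover have "p i \<in> span {y i, y (i + 1)}" for i unfolding p in_span2 by blast
  moreover have "dim (range p) \<le> 3"
  proof -
    have "p 4 = p 1 - p 2 + p 3" by (simp add: p index4(1-3))
    then have "p 4 \<in> span {p 1, p 2, p 3}"
      by (simp only:) (intro span_add span_diff span_base; simp)
    moreover have "range p = insert (p 4) {p 1, p 2, p 3}" by (auto simp: UNIV_4)
    ultimately have "dim (range p) = dim {p 1, p 2, p 3}" by (simp only: dim_insert if_True)
    also have "\<dots> \<le> card {p 1, p 2, p 3}" by (intro dim_le_card') simp
    also have "\<dots> \<le> 3" by (auto simp: card_insert_if)
    finally show ?thesis .
  qed
  ultimately show ?thesis unfolding adapted_cross_def hcoplanar_def by blast
qed

section \<open>Weighted homogeneous vectors of a net\<close>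

definition weighted :: "('v \<Rightarrow> real^3) \<Rightarrow> ('v \<Rightarrow> real) \<Rightarrow> 'v \<Rightarrow> hpoint" where
  "weighted X \<rho> z = \<rho> z *\<^sub>R hom (X z)"

lemma net_cross_weighted:
  "net_cross X \<rho> z e f i = quad_values (weighted X \<rho>) z e f i + quad_values (weighted X \<rho>) z e f (i + 1)"
  by (simp add: net_cross_def cross_vertex_def net_quad_def quad_values_def quadruple_def weighted_def)

lemma quad_values_weighted:
  "quad_values (weighted X \<rho>) z e f i = quad_values \<rho> z e f i *\<^sub>R net_quad X z e f i"
  by (simp add: net_quad_def quad_values_def quadruple_def weighted_def)

lemma adapted_cross_net:
  assumes "skew_quad (net_quad X z e f)" "\<And>i. quad_values \<rho> z e f i \<noteq> 0"
  shows "adapted_cross (net_quad X z e f) (net_cross X \<rho> z e f)"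
  by (rule adapted_cross_weighted[OF assms]) (simp add: net_cross_weighted quad_values_weighted)

lemma indep4_weighted:
  assumes "skew_quad (net_quad X z e f)" "\<And>i. quad_values \<rho> z e f i \<noteq> 0"
  shows "indep4 (weighted X \<rho> z) (weighted X \<rho> (z + e)) (weighted X \<rho> (z + e + f)) (weighted X \<rho> (z + f))"
proof -
  let ?r = "quad_values \<rho> z e f"
  have "indep4 (?r 1 *\<^sub>R net_quad X z e f 1) (?r 2 *\<^sub>R net_quad X z e f 2)
      (?r 3 *\<^sub>R net_quad X z e f 3) (?r 4 *\<^sub>R net_quad X z e f 4)"
    using assms by (intro indep4_scale) (simp_all add: skew_quad_iff)
  then show ?thesis by (simp add: quad_values_def net_quad_def weighted_def)
qed

lemma quad_values_nonzero:
  assumes "\<forall>z\<in>D. \<rho> z \<noteq> 0" "elementary_quad E D z e f"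
  shows "quad_values \<rho> z e f i \<noteq> 0"
  using assms by (simp add: elementary_quad_def quad_values_def quadruple_def)

lemma C1_net_iff:
  assumes \<rho>: "\<forall>z\<in>D. \<rho> z \<noteq> 0" and skew: "all_quads_skew E D X"
  shows "C1_net E D X \<rho> \<longleftrightarrow>
    (\<forall>z e f. elementary_quad E D z e f \<and> elementary_quad E D (z + e) e f \<longrightarrow>
      prop_mod (weighted X \<rho> (z + e)) (weighted X \<rho> (z + e + f))
        (weighted X \<rho> (z + e + e)) (weighted X \<rho> (z + e + e + f))
        (weighted X \<rho> z) (weighted X \<rho> (z + f)))"
proof -
  have "C1_along (inc {hom (X (z + e)), hom (X (z + e + f))})
          (net_quad X z e f) (net_cross X \<rho> z e f)
          (net_quad X (z + e) e f) (net_cross X \<rho> (z + e) e f) \<longleftrightarrow>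
      prop_mod (weighted X \<rho> (z + e)) (weighted X \<rho> (z + e + f))
        (weighted X \<rho> (z + e + e)) (weighted X \<rho> (z + e + e + f))
        (weighted X \<rho> z) (weighted X \<rho> (z + f))"
    if q: "elementary_quad E D z e f" "elementary_quad E D (z + e) e f" for z e f
  proof -
    let ?w = "quad_values (weighted X \<rho>) z e f" and ?v = "quad_values (weighted X \<rho>) (z + e) e f"
    have s: "skew_quad (net_quad X z e f)" "skew_quad (net_quad X (z + e) e f)"
      using skew q unfolding all_quads_skew_def by blast+
    note n = quad_values_nonzero[OF \<rho> q(1)] quad_values_nonzero[OF \<rho> q(2)]
    have "C1_along (inc {net_quad X z e f 2, net_quad X z e f 3})
          (net_quad X z e f) (net_cross X \<rho> z e f)
          (net_quad X (z + e) e f) (net_cross X \<rho> (z + e) e f) \<longleftrightarrow>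
        prop_mod (?w 2) (?w 3) (?v 2) (?v 3) (?w 1) (?w 4)"
      by (rule C1_along_iff[where w = ?w and r = "quad_values \<rho> z e f" and
            v = ?v and s = "quad_values \<rho> (z + e) e f", OF quad_values_weighted n(1) net_cross_weighted
            quad_values_weighted n(2) net_cross_weighted])
        (use indep4_weighted[OF s(1) n(1)] indep4_weighted[OF s(2) n(2)] in
          \<open>simp_all add: quad_values_def\<close>)
    then show ?thesis by (simp add: quad_values_def net_quad_def)
  qed
  then show ?thesis unfolding C1_net_def by blast
qed

section \<open>Propagation of the cube condition\<close>

text \<open>The eight images of the standard pair of directions under the symmetries of the square.
  They let one propagation argument cover all lattice directions and all edges of a
  quadrilateral.\<close>

definition frame :: "int \<times> int \<Rightarrow> int \<times> int \<Rightarrow> bool" where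
  "frame e f \<longleftrightarrow> e \<in> {(1, 0), (-1, 0)} \<and> f \<in> {(0, 1), (0, -1)} \<or>
     e \<in> {(0, 1), (0, -1)} \<and> f \<in> {(1, 0), (-1, 0)}"

text \<open>Exchanging the directions and reversing the first one generate all symmetries of the
  square.\<close>

lemma frame_induct [consumes 1, case_names base swap neg]:
  assumes "frame e f" "Q (1, 0) (0, 1)" "\<And>e f. Q e f \<Longrightarrow> Q f e" "\<And>e f. Q e f \<Longrightarrow> Q (- e) f"
  shows "Q e f"
proof -
  have 1: "Q (-1, 0) (0, 1)" using assms(4)[OF assms(2)] by simp
  note 2 = assms(3)[OF assms(2)] assms(3)[OF 1]
  have 3: "Q (0, -1) (1, 0)" "Q (0, -1) (-1, 0)" using assms(4)[OF 2(1)] assms(4)[OF 2(2)] by simp_all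
  note 1 2 3 assms(3)[OF 3(1)] assms(3)[OF 3(2)]
  with assms show ?thesis unfolding frame_def by auto
qed

lemma frame_swap: "frame e f \<Longrightarrow> frame f e"
  and frame_neg: "frame e f \<Longrightarrow> frame e (- f)"
  by (auto simp: frame_def)

text \<open>One half of the cube condition at the edge from \<open>z\<close> to
  \<open>z + e\<close>; the other half exchanges \<open>w\<close> and \<open>w'\<close>. The
  direction \<open>f\<close> points into the quadrilateral.\<close>

definition cube_edge :: "('v::ab_group_add \<Rightarrow> 'a::real_vector) \<Rightarrow> ('v \<Rightarrow> 'a) \<Rightarrow> 'v \<Rightarrow> 'v \<Rightarrow> 'v \<Rightarrow> bool" where
  "cube_edge w w' e f z \<longleftrightarrow>
     prop_mod (w z) (w (z + e)) (w' z) (w' (z + e)) (w (z + f)) (w (z + e + f))"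

definition cube_edges :: "('v::ab_group_add \<Rightarrow> 'a::real_vector) \<Rightarrow> ('v \<Rightarrow> 'a) \<Rightarrow> 'v \<Rightarrow> 'v \<Rightarrow> 'v \<Rightarrow> bool" where
  "cube_edges w w' e f z \<longleftrightarrow> cube_edge w w' e f z \<and> cube_edge w w' e (- f) (z + f) \<and>
     cube_edge w w' f e z \<and> cube_edge w w' f (- e) (z + e)"

lemma cube_edge_neg: "cube_edge w w' (- e) f (z + e) \<longleftrightarrow> cube_edge w w' e f z"
  unfolding cube_edge_def by (auto simp: algebra_simps dest: prop_mod_swap)

lemma cube_edges_swap: "cube_edges w w' f e z \<longleftrightarrow> cube_edges w w' e f z"
  by (auto simp: cube_edges_def)

lemma cube_edges_neg: "cube_edges w w' (- e) f (z + e) \<longleftrightarrow> cube_edges w w' e f z"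
  using cube_edge_neg[of w w' e "- f" "z + f"] cube_edge_neg[of w w' e f z]
  by (auto simp: cube_edges_def algebra_simps)

text \<open>What both directions of the theorem assume, in a form symmetric in the layers and in the
  lattice directions. The vertical \<open>C1\<close> condition is left out, being a hypothesis in
  one direction and a conclusion in the other.\<close>

locale weighted_net_pair =
  fixes w w' :: "int \<times> int \<Rightarrow> 'a::euclidean_space" and P P' :: "int \<times> int \<Rightarrow> 'a set"
  assumes subspace: "subspace (P z)" "subspace (P' z)"
    and dim_plane: "dim (P z) = 3" "dim (P' z) = 3"
    and vertex: "w z \<in> P z" "w' z \<in> P' z" "w' z \<in> P z" "w z \<in> P' z"
    and neighbours: "frame e f \<Longrightarrow> w (z + e) \<in> P z" "frame e f \<Longrightarrow> w' (z + e) \<in> P' z"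
    and planes_Int: "P z \<inter> P' z \<subseteq> span {w z, w' z}"
    and skew: "frame e f \<Longrightarrow> indep4 (w z) (w (z + e)) (w (z + e + f)) (w (z + f))"
      "frame e f \<Longrightarrow> indep4 (w' z) (w' (z + e)) (w' (z + e + f)) (w' (z + f))"
    and skew_vertical: "frame e f \<Longrightarrow> indep4 (w z) (w (z + e)) (w' (z + e)) (w' z)"
    and C1: "frame e f \<Longrightarrow>
        prop_mod (w (z + e)) (w (z + e + f)) (w (z + e + e)) (w (z + e + e + f)) (w z) (w (z + f))"
      "frame e f \<Longrightarrow>
        prop_mod (w' (z + e)) (w' (z + e + f)) (w' (z + e + e)) (w' (z + e + e + f)) (w' z) (w' (z + f))"
begin

text \<open>Transfers every result of the locale to the exchanged layers.\<close>

lemma flip: "weighted_net_pair w' w P' P"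
proof
  show "indep4 (w' z) (w' (z + e)) (w (z + e)) (w z)" if "frame e f" for z e f
    by (rule indep4_rotate[OF indep4_rotate[OF indep4_reflect[OF skew_vertical[OF that, of z]]]])
  show "P' z \<inter> P z \<subseteq> span {w' z, w z}" for z
    using planes_Int[of z] by (simp add: insert_commute Int_commute)
qed (fact subspace dim_plane vertex neighbours skew C1)+

lemma plane_eq: "frame e f \<Longrightarrow> P z = span {w z, w (z + e), w (z + f)}"
  using skew(1)[of f e z, THEN indep4_rotate] skew(1)[of e f z, THEN indep4_rotate, THEN indep4_rotate, THEN indep4_rotate]
    plane_eq_span[of "w (z + f)" "w z" "w (z + e)" _ "P z"] neighbours(1)[of e f z] neighbours(1)[of f e z]
  by (simp add: subspace dim_plane vertex insert_commute frame_swap)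

text \<open>\<open>prop_mod_iff_span_Int\<close> applies because each vertex lies in the vertex
  plane of its partner, and that plane is spanned by the corner of the quadrilateral there. The
  corner at \<open>z + e\<close> uses the frame with \<open>- e\<close>.\<close>

lemma cube_edge_iff:
  assumes fr: "frame e f"
  shows "span {w z + w (z + e), w' z + w' (z + e)} =
      span {w z, w (z + e), w (z + e + f) + w (z + f)} \<inter>
      span {w' z, w' (z + e), w' (z + e + f) + w' (z + f)} \<longleftrightarrow>
    cube_edge w w' e f z \<and> cube_edge w' w e f z"
proof -
  interpret flip: weighted_net_pair w' w P' P by (rule flip)
  have fr': "frame (- e) f" using fr by (auto simp: frame_def)
  show ?thesis
    unfolding cube_edge_def
    using vertex(3)[of z] vertex(3)[of "z + e"] vertex(4)[of z] vertex(4)[of "z + e"]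
      plane_eq[OF fr, of z] plane_eq[OF fr', of "z + e"]
      flip.plane_eq[OF fr, of z] flip.plane_eq[OF fr', of "z + e"]
    by (intro prop_mod_iff_span_Int skew[OF fr] skew_vertical[OF fr]) (simp_all add: insert_commute)
qed

context
  fixes e f z
  assumes fr: "frame e f" and cube: "cube_edges w w' e f z"
begin

text \<open>By transitivity: across the common edge, the old and the new opposite vertices are
  proportional modulo that edge.\<close>

lemma shared_edge: "cube_edge w w' f e (z + e)"
  using cube prop_mod_sym[OF C1(1)[OF fr, of z]] prop_mod_trans
  unfolding cube_edges_def cube_edge_def by (fastforce simp: algebra_simps)

lemma side_edge:
  assumes "prop_mod (w (z + e)) (w' (z + e)) (w (z + e + e)) (w' (z + e + e)) (w z) (w' z)"
  shows "cube_edge w w' e f (z + e)"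
proof -
  have "frame (- e) f" using fr by (auto simp: frame_def)
  \<comment> \<open>The vertex plane at \<open>z + e + e\<close> contains the partner point, which
    supplies the premise on \<open>C'\<close> in \<open>prop_mod_side_edge\<close>.\<close>
  then have "w' (z + e + e) \<in> span {w (z + e), w (z + e + e), w (z + e + e + f)}"
    using vertex(3)[of "z + e + e"] plane_eq[of "- e" f "z + e + e"] by (simp add: insert_commute)
  with assms show ?thesis
    unfolding cube_edge_def
    using cube
    by (intro prop_mod_side_edge[OF skew(1)[OF fr] C1(1)[OF fr], of z "w' (z + e)" "w' (z + e + f)" "w' z"
          "w' (z + e + e)"])
      (simp_all add: cube_edges_def cube_edge_def algebra_simps)
qed

lemma vertical_C1:
  assumes "cube_edge w w' e f (z + e)"
  shows "prop_mod (w (z + e)) (w' (z + e)) (w (z + e + e)) (w' (z + e + e)) (w z) (w' z)"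
proof -
  have fr': "frame (- e) f" using fr by (auto simp: frame_def)
  show ?thesis
    using assms cube neighbours(1)[OF fr', of "z + e"] neighbours(2)[OF fr', of "z + e"]
      neighbours(2)[OF fr, of "z + e"] neighbours(1)[OF frame_swap[OF fr], of "z + e"]
    by (intro prop_mod_vertical[OF skew(1)[OF fr] C1(1)[OF fr], of z "w' (z + e)" "w' (z + e + f)" "w' z"
          "w' (z + e + e)" "P (z + e)" "P' (z + e)"])
      (simp_all add: cube_edges_def cube_edge_def subspace vertex planes_Int algebra_simps)
qed

end

lemma cube_step:
  assumes fr: "frame e f"
    and cube: "cube_edges w w' e f z" "cube_edges w' w e f z"
    and V: "\<And>z. prop_mod (w (z + e)) (w' (z + e)) (w (z + e + e)) (w' (z + e + e)) (w z) (w' z)"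
  shows "cube_edges w w' e f (z + e)"
proof -
  interpret flip: weighted_net_pair w' w P' P by (rule flip)
  have V': "prop_mod (w' (z + e)) (w (z + e)) (w' (z + e + e)) (w (z + e + e)) (w' z) (w z)" for z
    using prop_mod_swap[OF V[of z]] .
  \<comment> \<open>The same cube seen from \<open>z + f\<close> with reversed \<open>f\<close>; in
    this way \<open>side_edge\<close> also covers the opposite side of the new
    quadrilateral.\<close>
  have cube': "cube_edges w w' e (- f) (z + f)" "cube_edges w' w e (- f) (z + f)"
    using cube cube_edges_neg[of w w' f e z] cube_edges_neg[of w' w f e z] by (simp_all add: cube_edges_swap)
  note e1 = shared_edge[OF fr cube(1)] side_edge[OF fr cube(1) V] side_edge[OF frame_neg[OF fr] cube'(1) V]
  note e2 = flip.shared_edge[OF fr cube(2)] flip.side_edge[OF fr cube(2) V']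
    flip.side_edge[OF frame_neg[OF fr] cube'(2) V']
  have fr': "frame (- e) f" using fr by (auto simp: frame_def)
  \<comment> \<open>The new quadrilateral is numbered from \<open>z + e + e\<close> backwards
    through \<open>z + e\<close>, so that the three known edges come first and the far edge is the
    fourth.\<close>
  have "prop_mod (w (z + e + e + f)) (w (z + e + e)) (w' (z + e + e + f)) (w' (z + e + e))
      (w (z + e + f)) (w (z + e))"
  proof (rule prop_mod_fourth_edge)
    show "indep4 (w (z + e + e)) (w (z + e)) (w (z + e + f)) (w (z + e + e + f))"
      "indep4 (w' (z + e + e)) (w' (z + e)) (w' (z + e + f)) (w' (z + e + e + f))"
      using skew[OF fr', of "z + e + e"] by (simp_all add: algebra_simps)
    show "indep4 (w (z + e + e + f)) (w (z + e + e)) (w' (z + e + e)) (w' (z + e + e + f))"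
      using indep4_reflect[OF skew_vertical[OF frame_swap[OF fr], of "z + e + e"]] .
  qed (use e1 e2 in \<open>auto simp: cube_edge_def algebra_simps dest: prop_mod_swap\<close>)
  then have "cube_edge w w' f (- e) (z + e + e)"
    unfolding cube_edge_def by (auto simp: algebra_simps dest: prop_mod_swap)
  with e1 show ?thesis unfolding cube_edges_def by (simp add: algebra_simps)
qed

lemma cube_everywhere:
  assumes V: "\<And>e f z. frame e f \<Longrightarrow>
      prop_mod (w (z + e)) (w' (z + e)) (w (z + e + e)) (w' (z + e + e)) (w z) (w' z)"
    and cube: "cube_edges w w' (1, 0) (0, 1) z\<^sub>0" "cube_edges w' w (1, 0) (0, 1) z\<^sub>0"
  shows "cube_edges w w' (1, 0) (0, 1) z \<and> cube_edges w' w (1, 0) (0, 1) z"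
proof -
  interpret flip: weighted_net_pair w' w P' P by (rule flip)
  define Q where "Q e f z \<longleftrightarrow> cube_edges w w' e f z \<and> cube_edges w' w e f z" for e f z
  have up: "Q e f (z + e)" if "frame e f" "Q e f z" for e f z
    using that cube_step[OF that(1)] flip.cube_step[OF that(1)] V[OF that(1)]
      prop_mod_swap[OF V[OF that(1)]] unfolding Q_def by blast
  \<comment> \<open>The quadrilateral at \<open>z\<close> for \<open>e\<close> is the one at
    \<open>z + e\<close> for \<open>- e\<close>, so a step backwards is a forward step in the
    reversed frame.\<close>
  have down: "Q e f (z - e)" if "frame e f" "Q e f z" for e f z
  proof -
    have "frame (- e) f" using that(1) by (auto simp: frame_def)
    moreover have "Q (- e) f (z + e)" using that(2) by (simp add: Q_def cube_edges_neg)
    ultimately have "Q (- e) f z" using up[of "- e" f "z + e"] by simp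
    then show ?thesis
      using cube_edges_neg[of w w' e f "z - e"] cube_edges_neg[of w' w e f "z - e"] by (simp add: Q_def)
  qed
  have fr: "frame (1, 0) (0, 1)" by (simp add: frame_def)
  obtain a b where z0: "z\<^sub>0 = (a, b)" by (cases z\<^sub>0)
  obtain m n where z: "z = (m, n)" by (cases z)
  \<comment> \<open>First along the row of the given cube, then along the column, with the two
    directions exchanged.\<close>
  have "Q (1, 0) (0, 1) (m, b)"
  proof (induction m rule: int_induct[where k = a])
    case base
    show ?case using cube by (simp add: Q_def z0)
  qed (use up[OF fr] down[OF fr] in force)+
  then have "Q (0, 1) (1, 0) (m, b)" by (simp add: Q_def cube_edges_swap)
  then have "Q (0, 1) (1, 0) (m, n)"
  proof (induction n rule: int_induct[where k = b])
    case (step1 n)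
    then show ?case using up[OF frame_swap[OF fr], of "(m, n)"] by simp
  next
    case (step2 n)
    then show ?case using down[OF frame_swap[OF fr], of "(m, n)"] by simp
  qed
  then show ?thesis by (simp add: Q_def cube_edges_swap z)
qed

end

section \<open>Two-layer nets\<close>

lemma weighted_two_layer:
  "weighted (two_layer x x') (two_layer \<rho> \<rho>') = two_layer (weighted x \<rho>) (weighted x' \<rho>')"
  by (auto simp: weighted_def two_layer_def fun_eq_iff)

lemma frame_axes2: "frame e f \<Longrightarrow> z + e \<in> star axes2 UNIV z"
  by (cases z) (auto simp: frame_def star_def axes2_def)

lemma elementary_quad_axes2:
  "elementary_quad axes2 UNIV z e f \<longleftrightarrow> e = (1, 0) \<and> f = (0, 1) \<or> e = (0, 1) \<and> f = (1, 0)"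
proof -
  have "(1::int, 0::int) \<noteq> (0, 1)" by simp
  then show ?thesis unfolding elementary_quad_def axes2_def by blast
qed

lemma indep4_swap: "indep4 a b c d \<Longrightarrow> indep4 a d c b"
  by (rule indep4_reflect[OF indep4_rotate[OF indep4_rotate[OF indep4_rotate]]])

text \<open>Exchanging the directions reverses the cyclic order of the quadrilateral; reversing
  \<open>e\<close> moves its base point to a neighbour.\<close>

lemma skew_frame:
  assumes "A_surface x" "\<And>z. \<rho> z \<noteq> 0" "frame e f"
  shows "indep4 (weighted x \<rho> z) (weighted x \<rho> (z + e)) (weighted x \<rho> (z + e + f)) (weighted x \<rho> (z + f))"
  using assms(3)
proof (induction e f arbitrary: z rule: frame_induct)
  case base
  have "skew_quad (net_quad x z (1, 0) (0, 1))"
    using assms(1) unfolding A_surface_def A_net_def all_quads_skew_def elementary_quad_axes2 by blast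
  then show ?case by (rule indep4_weighted) (simp add: quad_values_def quadruple_def assms(2))
next
  case (swap e f)
  from indep4_swap[OF swap[of z]] show ?case by (simp add: algebra_simps)
next
  case (neg e f)
  from indep4_reflect[OF neg[of "z - e"]] show ?case by (simp add: algebra_simps)
qed

lemma C1_frame:
  assumes "pre_hyperbolic x \<rho>" "frame e f"
  shows "prop_mod (weighted x \<rho> (z + e)) (weighted x \<rho> (z + e + f)) (weighted x \<rho> (z + e + e))
    (weighted x \<rho> (z + e + e + f)) (weighted x \<rho> z) (weighted x \<rho> (z + f))"
proof -
  let ?w = "weighted x \<rho>"
  let ?C = "\<lambda>e f z. prop_mod (?w (z + e)) (?w (z + e + f)) (?w (z + e + e)) (?w (z + e + e + f))
    (?w z) (?w (z + f))"
  \<comment> \<open>Both roles of the directions are carried together: reversing \<open>e\<close>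
    exchanges the two quadrilaterals in the first conjunct and reverses the common edge in the
    second.\<close>
  have "(\<forall>z. ?C e f z) \<and> (\<forall>z. ?C f e z)"
    using assms(2)
  proof (induction rule: frame_induct)
    case base
    have "C1_net axes2 UNIV x \<rho>" "\<forall>z\<in>UNIV. \<rho> z \<noteq> 0" "all_quads_skew axes2 UNIV x"
      using assms(1) by (auto simp: pre_hyperbolic_def crisscrossed_A_net_def A_net_def)
    then have "?C e f z" if "elementary_quad axes2 UNIV z e f" "elementary_quad axes2 UNIV (z + e) e f" for z e f
      using C1_net_iff[of UNIV \<rho> axes2 x] that by blast
    then show ?case by (simp add: elementary_quad_axes2)
  next
    case (neg e f)
    have "?C (- e) f z" for z
      using prop_mod_sym[OF neg[THEN conjunct1, rule_format, of "z - e - e"]]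
      by (simp add: algebra_simps)
    moreover have "?C f (- e) z" for z
      using prop_mod_swap[OF neg[THEN conjunct2, rule_format, of "z - e"]]
      by (simp add: algebra_simps)
    ultimately show ?case by blast
  qed blast
  then show ?thesis by blast
qed

section \<open>Pairs of pre-hyperbolic nets over a discrete Weingarten pair\<close>

context
  fixes x x' :: "int \<times> int \<Rightarrow> real^3" and \<rho> \<rho>' :: "int \<times> int \<Rightarrow> real"
  assumes pre: "pre_hyperbolic x \<rho>" "pre_hyperbolic x' \<rho>'"
    and pair: "discrete_Weingarten_pair x x'"
begin

private abbreviation (input) "w \<equiv> weighted x \<rho>"
private abbreviation (input) "w' \<equiv> weighted x' \<rho>'"
private abbreviation (input) "P \<equiv> vertex_plane axes2 UNIV x"
private abbreviation (input) "P' \<equiv> vertex_plane axes2 UNIV x'"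

lemma \<rho>_nonzero: "\<rho> z \<noteq> 0" "\<rho>' z \<noteq> 0"
  using pre unfolding pre_hyperbolic_def crisscrossed_A_net_def by blast+

lemma surfaces: "A_surface x" "A_surface x'"
  using pair unfolding discrete_Weingarten_pair_def by blast+

lemma planes_Int: "P z \<inter> P' z = span {hom (x z), hom (x' z)}"
  using pair unfolding discrete_Weingarten_pair_def by blast+

lemma hom_in_planes:
  "hom (x z) \<in> P z" "hom (x' z) \<in> P' z" "hom (x' z) \<in> P z" "hom (x z) \<in> P' z"
  by (rule subsetD[OF equalityD2[OF planes_Int], THEN IntD1] subsetD[OF equalityD2[OF planes_Int], THEN IntD2],
      rule span_base, simp)+

lemma hom_neighbours:
  assumes "frame e f"
  shows "hom (x (z + e)) \<in> P z" "hom (x' (z + e)) \<in> P' z"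
  unfolding vertex_plane_def by (intro span_base imageI frame_axes2[OF assms])+

lemma planes: "subspace (P z)" "subspace (P' z)" "dim (P z) = 3" "dim (P' z) = 3"
  using surfaces unfolding A_surface_def A_net_def by (simp_all add: vertex_plane_def)

lemma hom_vertical:
  assumes "frame e f"
  shows "indep4 (hom (x z)) (hom (x (z + e))) (hom (x' (z + e))) (hom (x' z))"
proof -
  have skew: "all_quads_skew axes3 layers (two_layer x x')"
    using pair by (simp add: discrete_Weingarten_pair_def)
  have *: "indep4 (hom (x z)) (hom (x (z + e))) (hom (x' (z + e))) (hom (x' z))"
    if "e \<in> {(1, 0), (0, 1)}" for e z
  proof -
    have "elementary_quad axes3 layers (z, 0) (e, 0) ((0, 0), 1)"
      using that by (auto simp: elementary_quad_def axes3_def layers_def)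
    with skew have "skew_quad (net_quad (two_layer x x') (z, 0) (e, 0) ((0, 0), 1))"
      unfolding all_quads_skew_def by blast
    then show ?thesis
      by (simp add: skew_quad_iff net_quad_def quad_values_def two_layer_def flip: zero_prod_def)
  qed
  have "e \<in> {(1, 0), (0, 1)} \<or> - e \<in> {(1, 0), (0, 1)}" using assms by (auto simp: frame_def)
  then show ?thesis
  proof
    assume "- e \<in> {(1, 0), (0, 1)}"
    from indep4_reflect[OF *[OF this, of "z + e"]] show ?thesis by simp
  qed (rule *)
qed

lemma weighted_net_pair: "weighted_net_pair w w' P P'"
proof
  show "P z \<inter> P' z \<subseteq> span {w z, w' z}" for z
    by (simp add: planes_Int weighted_def span_scale2 \<rho>_nonzero)
  show "indep4 (w z) (w (z + e)) (w' (z + e)) (w' z)" if "frame e f" for e f z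
    unfolding weighted_def by (intro indep4_scale \<rho>_nonzero hom_vertical[OF that])
  show "subspace (P z)" "subspace (P' z)" "dim (P z) = 3" "dim (P' z) = 3" for z by (fact planes)+
  show "w z \<in> P z" "w' z \<in> P' z" "w' z \<in> P z" "w z \<in> P' z" for z
    unfolding weighted_def by (intro subspace_scale planes hom_in_planes)+
  show "w (z + e) \<in> P z" "w' (z + e) \<in> P' z" if "frame e f" for e f z
    unfolding weighted_def by (intro subspace_scale planes hom_neighbours[OF that])+
  show "indep4 (w z) (w (z + e)) (w (z + e + f)) (w (z + f))"
    "indep4 (w' z) (w' (z + e)) (w' (z + e + f)) (w' (z + f))" if "frame e f" for e f z
    by (intro skew_frame surfaces \<rho>_nonzero that)+
qed (rule C1_frame[OF pre(1)] C1_frame[OF pre(2)], assumption)+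

text \<open>The second layer adds one point to each star, and by the Weingarten property this point
  already lies in the vertex plane.\<close>

lemma vertex_plane_layers:
  "vertex_plane axes3 layers (two_layer x x') (z, 0) = P z"
  "vertex_plane axes3 layers (two_layer x x') (z, 1) = P' z"
proof -
  have "star axes3 layers (z, 0) = insert (z, 1) ((\<lambda>u. (u, 0)) ` star axes2 UNIV z)"
    "star axes3 layers (z, 1) = insert (z, 0) ((\<lambda>u. (u, 1)) ` star axes2 UNIV z)"
    by (cases z; auto simp: star_def axes3_def axes2_def layers_def)+
  then have "vertex_plane axes3 layers (two_layer x x') (z, 0) =
      span (insert (hom (x' z)) ((\<lambda>u. hom (x u)) ` star axes2 UNIV z))"
    "vertex_plane axes3 layers (two_layer x x') (z, 1) =
      span (insert (hom (x z)) ((\<lambda>u. hom (x' u)) ` star axes2 UNIV z))"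
    by (simp_all add: vertex_plane_def two_layer_def image_image)
  then show "vertex_plane axes3 layers (two_layer x x') (z, 0) = P z"
    "vertex_plane axes3 layers (two_layer x x') (z, 1) = P' z"
    using hom_in_planes(3,4)[of z] by (simp_all add: vertex_plane_def span_redundant)
qed

text \<open>Reduces the notion of a Baecklund pair to its \<open>C1\<close> part: vertical crosses
  are adapted since the weights do not vanish and the faces are skew.\<close>

lemma two_layer_crisscrossed:
  "crisscrossed_A_net axes3 layers (two_layer x x') (two_layer \<rho> \<rho>')"
proof -
  have skew: "all_quads_skew axes3 layers (two_layer x x')"
    using pair unfolding discrete_Weingarten_pair_def by blast
  have \<rho>: "\<forall>z\<in>layers. two_layer \<rho> \<rho>' z \<noteq> 0"
    by (auto simp: two_layer_def \<rho>_nonzero split: if_splits)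
  have "dim (vertex_plane axes3 layers (two_layer x x') (z, 0)) = 3"
    "dim (vertex_plane axes3 layers (two_layer x x') (z, 1)) = 3" for z
    unfolding vertex_plane_layers by (fact planes)+
  moreover have "\<exists>u. z = (u, 0) \<or> z = (u, 1)" if "z \<in> layers" for z
    using that by (cases z) (simp add: layers_def, blast)
  ultimately have "\<forall>z\<in>layers. dim (vertex_plane axes3 layers (two_layer x x') z) = 3"
    by metis
  moreover have "adapted_cross (net_quad (two_layer x x') z e f) (net_cross (two_layer x x') (two_layer \<rho> \<rho>') z e f)"
    if "elementary_quad axes3 layers z e f" for z e f
    using adapted_cross_net[OF _ quad_values_nonzero[OF \<rho> that]] skew that
    unfolding all_quads_skew_def by blast
  ultimately show ?thesis
    using skew \<rho> unfolding crisscrossed_A_net_def A_net_def by blast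
qed

lemma two_layer_C1_iff:
  "C1_net axes3 layers (two_layer x x') (two_layer \<rho> \<rho>') \<longleftrightarrow>
    (\<forall>e\<in>{(1, 0), (0, 1)}. \<forall>z.
      prop_mod (w (z + e)) (w' (z + e)) (w (z + e + e)) (w' (z + e + e)) (w z) (w' z))"
  (is "?C1 \<longleftrightarrow> ?V")
proof -
  have "all_quads_skew axes3 layers (two_layer x x')" "\<forall>z\<in>layers. two_layer \<rho> \<rho>' z \<noteq> 0"
    using two_layer_crisscrossed unfolding crisscrossed_A_net_def A_net_def by blast+
  note iff = C1_net_iff[OF this(2,1), unfolded weighted_two_layer]
  \<comment> \<open>Two consecutive quadrilaterals need \<open>z\<close>, \<open>z + e\<close> and
    \<open>z + e + e\<close> in the domain, so with two layers \<open>e\<close> must be horizontal;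
    a vertical \<open>f\<close> forces \<open>k = 0\<close>.\<close>
  have quad: "(\<exists>e'. e = (e', 0) \<and> (\<exists>f'. f = (f', 0) \<and> frame e' f' \<and> (k = 0 \<or> k = 1))) \<or>
      (\<exists>e'\<in>{(1, 0), (0, 1)}. e = (e', 0) \<and> f = ((0, 0), 1) \<and> k = 0)"
    if "elementary_quad axes3 layers (z, k) e f" "elementary_quad axes3 layers ((z, k) + e) e f"
    for z :: "int \<times> int" and k e f
  proof -
    from that have ef: "e \<in> axes3" "f \<in> axes3" "e \<noteq> f"
      and "(z, k) \<in> layers" "(z, k) + f \<in> layers" "(z, k) + e + e \<in> layers"
      by (simp_all add: elementary_quad_def)
    then have k: "k = 0 \<or> k = 1" "k + snd f = 0 \<or> k + snd f = 1" "k + snd e + snd e = 0 \<or> k + snd e + snd e = 1"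
      by (cases e; cases f; simp add: layers_def)+
    from ef k show ?thesis
      unfolding axes3_def insert_iff empty_iff by (elim disjE; simp add: frame_def)
  qed
  show ?thesis
    unfolding iff
  proof (intro iffI ballI allI impI, goal_cases)
    case (1 e z)
    then have "elementary_quad axes3 layers (z, 0) (e, 0) ((0, 0), 1)"
      "elementary_quad axes3 layers ((z, 0) + (e, 0)) (e, 0) ((0, 0), 1)"
      by (auto simp: elementary_quad_def axes3_def layers_def)
    with 1(1) show ?case by (force simp: two_layer_def simp flip: zero_prod_def)
  next
    case (2 zk e f)
    obtain z k where zk: "zk = (z, k)" by (cases zk)
    from 2(2) have "elementary_quad axes3 layers (z, k) e f" "elementary_quad axes3 layers ((z, k) + e) e f"
      unfolding zk by blast+
    from quad[OF this] consider
        (hor) e' f' where "e = (e', 0)" "f = (f', 0)" "frame e' f'" "k = 0 \<or> k = 1"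
      | (ver) e' where "e' \<in> {(1, 0), (0, 1)}" "e = (e', 0)" "f = ((0, 0), 1)" "k = 0"
      by blast
    then show ?case
    proof cases
      case hor
      then show ?thesis
        using C1_frame[OF pre(1) hor(3), of z] C1_frame[OF pre(2) hor(3), of z]
        by (auto simp: zk two_layer_def)
    next
      case ver
      then show ?thesis
        using 2(1)[rule_format, OF ver(1), of z] by (simp add: zk two_layer_def flip: zero_prod_def)
    qed
  qed
qed

text \<open>Skew faces, planar stars and crosses come from the hypotheses on the pair, so only the
  line conditions at the four edges carry content.\<close>

lemma Weingarten_cube_iff:
  assumes fr: "frame e f"
  shows "Weingarten_cube (net_quad x z e f) (net_cross x \<rho> z e f) (net_quad x' z e f) (net_cross x' \<rho>' z e f) \<longleftrightarrow>
    cube_edges w w' e f z \<and> cube_edges w' w e f z"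
proof -
  interpret weighted_net_pair w w' P P' by (rule weighted_net_pair)
  let ?y = "net_quad x z e f" and ?p = "net_cross x \<rho> z e f"
    and ?y' = "net_quad x' z e f" and ?p' = "net_cross x' \<rho>' z e f"
  \<comment> \<open>Frames met when going once around the quadrilateral, the second direction always
    pointing inwards.\<close>
  have fr2: "frame f (- e)" "frame (- e) (- f)" "frame (- f) e" "frame (- e) f"
    using fr by (auto simp: frame_def)
  have skews: "skew_quad ?y" "skew_quad ?y'"
    \<comment> \<open>Weight 1 gives skewness of the unweighted vertices.\<close>
    using skew_frame[OF surfaces(1) _ fr, of "\<lambda>_. 1" z] skew_frame[OF surfaces(2) _ fr, of "\<lambda>_. 1" z]
    by (simp_all add: skew_quad_iff net_quad_def quad_values_def weighted_def)
  have vert: "\<forall>i. skew_quad (quadruple (?y i) (?y (i + 1)) (?y' (i + 1)) (?y' i))"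
    using hom_vertical[OF fr, of z] hom_vertical[OF fr2(1), of "z + e"]
      hom_vertical[OF fr2(2), of "z + e + f"] hom_vertical[OF fr2(3), of "z + f"]
    by (simp add: forall_4 index4 skew_quad_iff net_quad_def quad_values_def algebra_simps)
  have cop: "hcoplanar S" if "S \<subseteq> P u \<or> S \<subseteq> P' u" for S u
    using that dim_subset[of S "P u"] dim_subset[of S "P' u"] planes(3,4)[of u]
    unfolding hcoplanar_def by auto
  have star: "\<forall>i. hcoplanar {?y i, ?y (i - 1), ?y (i + 1), ?y' i}"
    "\<forall>i. hcoplanar {?y' i, ?y' (i - 1), ?y' (i + 1), ?y i}"
    using cop[of _ z] cop[of _ "z + e"] cop[of _ "z + e + f"] cop[of _ "z + f"]
      hom_in_planes[of z] hom_in_planes[of "z + e"] hom_in_planes[of "z + e + f"] hom_in_planes[of "z + f"]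
      hom_neighbours[OF fr, of z] hom_neighbours[OF frame_swap[OF fr], of z]
      hom_neighbours[OF fr2(4), of "z + e"] hom_neighbours[OF fr2(1), of "z + e"]
      hom_neighbours[OF fr2(2), of "z + e + f"] hom_neighbours[OF fr2(3), of "z + e + f"]
      hom_neighbours[OF fr, of "z + f"] hom_neighbours[OF fr2(3), of "z + f"]
    by (simp_all add: forall_4 index4 net_quad_def quad_values_def algebra_simps)
  have cross: "adapted_cross ?y ?p" "adapted_cross ?y' ?p'"
    by (intro adapted_cross_net skews; simp add: quad_values_def quadruple_def \<rho>_nonzero)+
  have s: "span {hom (x u), hom (x v), c} = span {w u, w v, c}"
    "span {hom (x' u), hom (x' v), c} = span {w' u, w' v, c}" for u v c
    by (simp_all add: weighted_def span_scale3 \<rho>_nonzero)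
  have "(\<forall>i. inc {?p i, ?p' i} =
        inc {?y i, ?y (i + 1), ?p (i + 2)} \<inter> inc {?y' i, ?y' (i + 1), ?p' (i + 2)}) \<longleftrightarrow>
      (cube_edge w w' e f z \<and> cube_edge w' w e f z) \<and>
      (cube_edge w w' f (- e) (z + e) \<and> cube_edge w' w f (- e) (z + e)) \<and>
      (cube_edge w w' (- e) (- f) (z + f + e) \<and> cube_edge w' w (- e) (- f) (z + f + e)) \<and>
      (cube_edge w w' (- f) e (z + f) \<and> cube_edge w' w (- f) e (z + f))"
    unfolding cube_edge_iff[OF fr, symmetric] cube_edge_iff[OF fr2(1), symmetric]
      cube_edge_iff[OF fr2(2), symmetric] cube_edge_iff[OF fr2(3), symmetric]
    by (simp add: forall_4 index4 net_cross_weighted net_quad_def quad_values_def s algebra_simps)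
  then show ?thesis
    unfolding Weingarten_cube_def cube_edges_def cube_edge_neg
    using skews vert star cross by blast
qed

end

theorem proposition36:
  fixes x x' :: "int \<times> int \<Rightarrow> real^3" and \<rho> \<rho>' :: "int \<times> int \<Rightarrow> real"
  shows "(Baecklund_pair x \<rho> x' \<rho>' \<and> (\<exists>z. Weingarten_cube_at x \<rho> x' \<rho>' z) \<longrightarrow>
            Weingarten_pair x \<rho> x' \<rho>') \<and>
         (Weingarten_pair x \<rho> x' \<rho>' \<longrightarrow> Baecklund_pair x \<rho> x' \<rho>')"
\<comment> \<open>Both notions of pair include these three conditions; without them all implications
  hold vacuously.\<close>
proof (cases "pre_hyperbolic x \<rho> \<and> pre_hyperbolic x' \<rho>' \<and> discrete_Weingarten_pair x x'")
  case False
  then show ?thesis unfolding Baecklund_pair_def Weingarten_pair_def by blast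
next
  case True
  then have pre: "pre_hyperbolic x \<rho>" "pre_hyperbolic x' \<rho>'" "discrete_Weingarten_pair x x'" by auto
  let ?w = "weighted x \<rho>" and ?w' = "weighted x' \<rho>'"
  interpret weighted_net_pair ?w ?w' "vertex_plane axes2 UNIV x" "vertex_plane axes2 UNIV x'"
    by (rule weighted_net_pair[OF pre])
  let ?V = "\<lambda>e z. prop_mod (?w (z + e)) (?w' (z + e)) (?w (z + e + e)) (?w' (z + e + e)) (?w z) (?w' z)"
  have B: "Baecklund_pair x \<rho> x' \<rho>' \<longleftrightarrow> (\<forall>e\<in>{(1, 0), (0, 1)}. \<forall>z. ?V e z)"
    unfolding Baecklund_pair_def two_layer_C1_iff[OF pre] using pre two_layer_crisscrossed[OF pre] by blast
  have W: "Weingarten_cube_at x \<rho> x' \<rho>' z \<longleftrightarrow>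
      cube_edges ?w ?w' (1, 0) (0, 1) z \<and> cube_edges ?w' ?w (1, 0) (0, 1) z" for z
    unfolding Weingarten_cube_at_def by (rule Weingarten_cube_iff[OF pre]) (simp add: frame_def)
  show ?thesis
  proof (intro conjI impI)
    assume "Baecklund_pair x \<rho> x' \<rho>' \<and> (\<exists>z. Weingarten_cube_at x \<rho> x' \<rho>' z)"
    then obtain z\<^sub>0 where V: "\<forall>e\<in>{(1, 0), (0, 1)}. \<forall>z. ?V e z" and z0: "Weingarten_cube_at x \<rho> x' \<rho>' z\<^sub>0"
      unfolding B by blast
    \<comment> \<open>The vertical condition is symmetric under reversal of the direction, so it
      extends from the unit vectors to their negatives.\<close>
    have V': "?V e z" if "frame e f" for e f z
    proof -
      have "e \<in> {(1, 0), (0, 1)} \<or> - e \<in> {(1, 0), (0, 1)}" using that by (auto simp: frame_def)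
      then show ?thesis
      proof
        assume "- e \<in> {(1, 0), (0, 1)}"
        with V have "?V (- e) (z + e + e)" by blast
        from prop_mod_sym[OF this] show ?thesis by simp
      qed (use V in blast)
    qed
    have "Weingarten_cube_at x \<rho> x' \<rho>' z" for z
      unfolding W
    proof (rule cube_everywhere[where z\<^sub>0 = z\<^sub>0])
      show "?V e z" if "frame e f" for e f z by (rule V'[OF that])
    qed (use z0 in \<open>simp_all add: W\<close>)
    with pre show "Weingarten_pair x \<rho> x' \<rho>'" unfolding Weingarten_pair_def by blast
  next
    assume "Weingarten_pair x \<rho> x' \<rho>'"
    then have cube: "cube_edges ?w ?w' (1, 0) (0, 1) z" for z
      unfolding Weingarten_pair_def W by blast
    then have cube': "cube_edges ?w ?w' (0, 1) (1, 0) z" for z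
      using cube_edges_swap by blast
    have fr: "frame (1, 0) (0, 1)" "frame (0, 1) (1, 0)" by (simp_all add: frame_def)
    show "Baecklund_pair x \<rho> x' \<rho>'"
      unfolding B
      \<comment> \<open>Each vertical condition results from the cube at \<open>z\<close> and one
        edge condition of the cube at \<open>z + e\<close>.\<close>
      using vertical_C1[OF fr(1) cube] vertical_C1[OF fr(2) cube'] cube cube'
      unfolding cube_edges_def by blast
  qed
qed

end
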